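(* Let $q>2$ and consider the $q$-state Potts model with Hamiltonian $H$ on the $K\times L$ torus $\Lambda$. Let $\mathbf r\in\mathcal X^s$. Then each of the following sets is a minimal gate for the transition $\mathbf r\to\mathcal X^s\setminus\{\mathbf r\}$: (a) $\bigcup_{\mathbf t\in\mathcal X^s\setminus\{\mathbf r\}}\overline{\mathcal P}(\mathbf r,\mathbf t)$ and $\bigcup_{\mathbf t\in\mathcal X^s\setminus\{\mathbf r\}}\widetilde{\mathcal P}(\mathbf r,\mathbf t)$; (b) $\bigcup_{\mathbf t\in\mathcal X^s\setminus\{\mathbf r\}}\overline{\mathcal Q}(\mathbf r,\mathbf t)$ and $\bigcup_{\mathbf t\in\mathcal X^s\setminus\{\mathbf r\}}\widetilde{\mathcal Q}(\mathbf r,\mathbf t)$; (c) $\bigcup_{\mathbf t\in\mathcal X^s\setminus\{\mathbf r\}}\overline{\mathcal H}_i(\mathbf r,\mathbf t)$ and $\bigcup_{\mathbf t\in\mathcal X^s\setminus\{\mathbf r\}}\widetilde{\mathcal H}_i(\mathbf r,\mathbf t)$, for any $i=1,\dots,K-3$; (d) $\bigcup_{\mathbf t\in\mathcal X^s\setminus\{\mathbf r\}}\mathcal W_j^{(h)}(\mathbf r,\mathbf t)$, for any $j=2,\dots,L-3$ and any $h=1,\dots,K-1$.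
   Context: Model. Fix integers $q$, $K<L$, $L\ge 3$. $\Lambda=(V,E)$ is the two-dimensional torus with $V=\{0,\dots,K-1\}\times\{0,\dots,L-1\}$ (vertex $(i,j)$ lies in row $i$ and column $j$; there are $K$ rows and $L$ columns) and $E$ the set of nearest-neighbour pairs with periodic boundary conditions. $S=\{1,\dots,q\}$, $\mathcal X=S^V$, $H(\sigma)=-\sum_{(v,w)\in E}1_{\{\sigma(v)=\sigma(w)\}}$. $Q(\sigma,\sigma')=1/(q|V|)$ if $\sigma,\sigma'$ differ at exactly one vertex, and $Q(\sigma,\sigma')=0$ if they differ at more than one vertex. For $s\in S$, bold $\mathbf s\in\mathcal X$ is the configuration constantly equal to $s$; $\mathcal X^s=\{\mathbf 1,\dots,\mathbf q\}$ is the set of global minima of $H$ (stable configurations). Paths, saddles, gates. A path $\omega:\sigma\to\sigma'$ is a finite sequence $\omega_0=\sigma,\dots,\omega_n=\sigma'$ in $\mathcal X$ with $Q(\omega_i,\omega_{i+1})>0$; $\Phi_\omega=\max_i H(\omega_i)$; $\Phi(\sigma,\sigma')=\min_{\omega:\sigma\to\sigma'}\Phi_\omega$; for a nonempty set $\mathcal A\not\ni\sigma$, $\Phi(\sigma,\mathcal A)=\min_{\sigma'\in\mathcal A}\Phi(\sigma,\sigma')$. $\Omega^{opt}_{\sigma,\mathcal A}$ is the set of paths $\omega$ from $\sigma$ to an element of $\mathcal A$ with $\Phi_\omega=\Phi(\sigma,\mathcal A)$ (optimal paths). $\mathcal S(\sigma,\mathcal A)$ is the set of $\xi\in\mathcal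 X$ such that there is $\omega\in\Omega^{opt}_{\sigma,\mathcal A}$ with $\xi\in\omega$ and $H(\xi)=\max_{\eta\in\omega}H(\eta)$ (minimal saddles). A gate for $\sigma\to\mathcal A$ is a subset $\mathcal W\subseteq\mathcal S(\sigma,\mathcal A)$ such that $\omega\cap\mathcal W\ne\varnothing$ for all $\omega\in\Omega^{opt}_{\sigma,\mathcal A}$. A gate $\mathcal W$ is a minimal gate if for every proper subset $\mathcal W'\subset\mathcal W$ there is $\omega'\in\Omega^{opt}_{\sigma,\mathcal A}$ with $\omega'\cap\mathcal W'=\varnothing$. Sets of configurations. For distinct spins $r,s$: $\bar R_{a,b}(r,s)$ is the set of configurations in which all spins are $r$ except those, equal to $s$, in a rectangle $a\times b$ of $\Lambda$ ($a$ = horizontal length, i.e. number of columns; $b$ = vertical length, i.e. number of rows). $\bar B^h_{a,b}(r,s)$, $1\le h\le b-1$, is the set of configurations in which all spins are $r$ except those, equal to $s$, in a rectangle $a\times b$ together with a bar $1\times h$ (one column wide, $h$ consecutive rows) adjacent to one of the sides of length $b$. $\tilde R_{a,b}(r,s)$, $\tilde B^h_{a,b}(r,s)$ are the same with the roles of $r$ and $s$ interchanged. Put $\overline{\mathcal P}(\mathbf r,\mathbf s)=\bar B^{K-1}_{1,K}(r,s)$; $\overline{\mathcal Q}(\mathbf r,\mathbf s)=\bar R_{2,K-1}(r,s)\cup\bar B^{K-2}_{1,K}(r,s)$; $\overline{\mathcal H}_i(\mathbf r,\mathbf s)=\bar B^i_{1,K}(r,s)\cup\bigcup_{h=i+1}^{K-2}\bar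 B^h_{1,K-1}(r,s)$ for $i=1,\dots,K-3$; and $\widetilde{\mathcal P},\widetilde{\mathcal Q},\widetilde{\mathcal H}_i$ by the same formulas with $\tilde R,\tilde B$ in place of $\bar R,\bar B$. Finally $\mathcal W_j^{(h)}(\mathbf r,\mathbf s)=\bar B^h_{j,K}(r,s)=\tilde B^{K-h}_{L-j-1,K}(r,s)$ for $j=2,\dots,L-3$, $h=1,\dots,K-1$.
   Formalization: The theorem assumes K ≥ 3. For K = 2, part (b) uses B^{K-2}_{1,K} = B^0_{1,2}, which is undefined (h ≥ 1 is required), and part (a) is false for K = 2, L = 3; for K = 1 the sets in (a) are already undefined. *)

theory Defs
  imports Complex_Main "HOL-Library.FuncSet"
begin

section \<open>The Potts model on the torus\<close>

type_synonym vertex = "nat \<times> nat"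
type_synonym config = "vertex \<Rightarrow> nat"

text \<open>A vertex \<open>(i, j)\<close> lies in row \<open>i\<close> and column \<open>j\<close>.\<close>

definition vertices :: "nat \<Rightarrow> nat \<Rightarrow> vertex set" where
  "vertices K L = {0..<K} \<times> {0..<L}"

definition edges :: "nat \<Rightarrow> nat \<Rightarrow> vertex set set" where
  "edges K L =
     {{(i, j), (i, (j + 1) mod L)} | i j. i < K \<and> j < L} \<union>
     {{(i, j), ((i + 1) mod K, j)} | i j. i < K \<and> j < L}"

definition spins :: "nat \<Rightarrow> nat set" where
  "spins q = {1..q}"

text \<open>Configurations are extensional functions, so that they are determined by their values
  on the vertices.\<close>

definition configs :: "nat \<Rightarrow> nat \<Rightarrow> nat \<Rightarrow> config set" where
  "configs q K L = vertices K L \<rightarrow>\<^sub>E spins q"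

definition energy :: "nat \<Rightarrow> nat \<Rightarrow> config \<Rightarrow> int" where
  "energy K L \<sigma> = - (\<Sum>e\<in>edges K L. of_bool (\<forall>v\<in>e. \<forall>w\<in>e. \<sigma> v = \<sigma> w))"

definition diff_set :: "nat \<Rightarrow> nat \<Rightarrow> config \<Rightarrow> config \<Rightarrow> vertex set" where
  "diff_set K L \<sigma> \<sigma>' = {v \<in> vertices K L. \<sigma> v \<noteq> \<sigma>' v}"

text \<open>The diagonal value \<open>1 / q\<close> is the one that makes each row of this matrix sum to 1: there are
  \<open>\<bar>V\<bar> (q - 1)\<close> configurations at distance one.\<close>

definition conn_matrix :: "nat \<Rightarrow> nat \<Rightarrow> nat \<Rightarrow> config \<Rightarrow> config \<Rightarrow> real" where
  "conn_matrix q K L \<sigma> \<sigma>' =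
     (if card (diff_set K L \<sigma> \<sigma>') = 0 then 1 / real q
      else if card (diff_set K L \<sigma> \<sigma>') = 1 then 1 / (real q * real (card (vertices K L)))
      else 0)"

definition const_config :: "nat \<Rightarrow> nat \<Rightarrow> nat \<Rightarrow> config" where
  "const_config K L s = (\<lambda>v\<in>vertices K L. s)"

definition stable_configs :: "nat \<Rightarrow> nat \<Rightarrow> nat \<Rightarrow> config set" where
  "stable_configs q K L = const_config K L ` spins q"


section \<open>Optimal paths, minimal saddles and gates\<close>

definition paths :: "nat \<Rightarrow> nat \<Rightarrow> nat \<Rightarrow> config \<Rightarrow> config \<Rightarrow> config list set" where
  "paths q K L \<sigma> \<sigma>' =
     {\<omega>. \<omega> \<noteq> [] \<and> hd \<omega> = \<sigma> \<and> last \<omega> = \<sigma>' \<and> set \<omega> \<subseteq> configs q K L \<and>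
         successively (\<lambda>\<xi> \<eta>. conn_matrix q K L \<xi> \<eta> > 0) \<omega>}"

definition height :: "nat \<Rightarrow> nat \<Rightarrow> config list \<Rightarrow> int" where
  "height K L \<omega> = Max (energy K L ` set \<omega>)"

text \<open>Although there are infinitely many paths, only finitely many heights occur, so the
  following minimum is attained.\<close>

definition comm_height :: "nat \<Rightarrow> nat \<Rightarrow> nat \<Rightarrow> config \<Rightarrow> config \<Rightarrow> int" where
  "comm_height q K L \<sigma> \<sigma>' = Min (height K L ` paths q K L \<sigma> \<sigma>')"

definition comm_height_set :: "nat \<Rightarrow> nat \<Rightarrow> nat \<Rightarrow> config \<Rightarrow> config set \<Rightarrow> int" where
  "comm_height_set q K L \<sigma> A = Min (comm_height q K L \<sigma> ` A)"

definition opt_paths :: "nat \<Rightarrow> nat \<Rightarrow> nat \<Rightarrow> config \<Rightarrow> config set \<Rightarrow> config list set" where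
  "opt_paths q K L \<sigma> A =
     {\<omega> \<in> (\<Union>\<sigma>'\<in>A. paths q K L \<sigma> \<sigma>'). height K L \<omega> = comm_height_set q K L \<sigma> A}"

definition saddles :: "nat \<Rightarrow> nat \<Rightarrow> nat \<Rightarrow> config \<Rightarrow> config set \<Rightarrow> config set" where
  "saddles q K L \<sigma> A =
     {\<xi> \<in> configs q K L. \<exists>\<omega>\<in>opt_paths q K L \<sigma> A.
        \<xi> \<in> set \<omega> \<and> energy K L \<xi> = Max (energy K L ` set \<omega>)}"

definition is_gate :: "nat \<Rightarrow> nat \<Rightarrow> nat \<Rightarrow> config \<Rightarrow> config set \<Rightarrow> config set \<Rightarrow> bool" where
  "is_gate q K L \<sigma> A W \<longleftrightarrow>
     W \<subseteq> saddles q K L \<sigma> A \<and> (\<forall>\<omega>\<in>opt_paths q K L \<sigma> A. set \<omega> \<inter> W \<noteq> {})"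

definition is_minimal_gate :: "nat \<Rightarrow> nat \<Rightarrow> nat \<Rightarrow> config \<Rightarrow> config set \<Rightarrow> config set \<Rightarrow> bool" where
  "is_minimal_gate q K L \<sigma> A W \<longleftrightarrow>
     is_gate q K L \<sigma> A W \<and>
     (\<forall>W'. W' \<subset> W \<longrightarrow> (\<exists>\<omega>\<in>opt_paths q K L \<sigma> A. set \<omega> \<inter> W' = {}))"


section \<open>Rectangles and bars\<close>

text \<open>\<open>rect K L i j a b\<close> consists of the \<open>b\<close> consecutive rows starting from row \<open>i\<close> and the
  \<open>a\<close> consecutive columns starting from column \<open>j\<close>, with periodic boundary conditions. Thus
  the first size parameter \<open>a\<close> is horizontal, although the row comes first in a vertex.\<close>

definition rect :: "nat \<Rightarrow> nat \<Rightarrow> nat \<Rightarrow> nat \<Rightarrow> nat \<Rightarrow> nat \<Rightarrow> vertex set" where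
  "rect K L i j a b = {((i + x) mod K, (j + y) mod L) | x y. x < b \<and> y < a}"

definition two_spin :: "nat \<Rightarrow> nat \<Rightarrow> vertex set \<Rightarrow> nat \<Rightarrow> nat \<Rightarrow> config" where
  "two_spin K L U r s = (\<lambda>v\<in>vertices K L. if v \<in> U then s else r)"

definition R_bar :: "nat \<Rightarrow> nat \<Rightarrow> nat \<Rightarrow> nat \<Rightarrow> nat \<Rightarrow> nat \<Rightarrow> config set" where
  "R_bar K L a b r s = {two_spin K L (rect K L i j a b) r s | i j. i < K \<and> j < L}"

text \<open>The bar occupies column \<open>j + a\<close> (right of the rectangle) or \<open>j - 1\<close> (left of it), and \<open>h\<close>
  consecutive ones of the \<open>b\<close> rows of the rectangle, i.e.\ every cell of the bar is adjacent to
  the side. If \<open>b = K\<close>, the side is a closed column, and all cyclic intervals of rows are covered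
  because the starting row \<open>i\<close> is arbitrary. The definition is meant for \<open>1 \<le> h \<le> b - 1\<close>.\<close>

definition B_bar :: "nat \<Rightarrow> nat \<Rightarrow> nat \<Rightarrow> nat \<Rightarrow> nat \<Rightarrow> nat \<Rightarrow> nat \<Rightarrow> config set" where
  "B_bar K L h a b r s =
     {two_spin K L (rect K L i j a b \<union> rect K L (i + d) c 1 h) r s | i j d c.
        i < K \<and> j < L \<and> d + h \<le> b \<and> c \<in> {j + a, j + L - 1}}"

definition R_tilde :: "nat \<Rightarrow> nat \<Rightarrow> nat \<Rightarrow> nat \<Rightarrow> nat \<Rightarrow> nat \<Rightarrow> config set" where
  "R_tilde K L a b r s = R_bar K L a b s r"

definition B_tilde :: "nat \<Rightarrow> nat \<Rightarrow> nat \<Rightarrow> nat \<Rightarrow> nat \<Rightarrow> nat \<Rightarrow> nat \<Rightarrow> config set" where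
  "B_tilde K L h a b r s = B_bar K L h a b s r"

definition P_bar :: "nat \<Rightarrow> nat \<Rightarrow> nat \<Rightarrow> nat \<Rightarrow> config set" where
  "P_bar K L r s = B_bar K L (K - 1) 1 K r s"

definition P_tilde :: "nat \<Rightarrow> nat \<Rightarrow> nat \<Rightarrow> nat \<Rightarrow> config set" where
  "P_tilde K L r s = B_tilde K L (K - 1) 1 K r s"

definition Q_bar :: "nat \<Rightarrow> nat \<Rightarrow> nat \<Rightarrow> nat \<Rightarrow> config set" where
  "Q_bar K L r s = R_bar K L 2 (K - 1) r s \<union> B_bar K L (K - 2) 1 K r s"

definition Q_tilde :: "nat \<Rightarrow> nat \<Rightarrow> nat \<Rightarrow> nat \<Rightarrow> config set" where
  "Q_tilde K L r s = R_tilde K L 2 (K - 1) r s \<union> B_tilde K L (K - 2) 1 K r s"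

definition H_bar :: "nat \<Rightarrow> nat \<Rightarrow> nat \<Rightarrow> nat \<Rightarrow> nat \<Rightarrow> config set" where
  "H_bar K L i r s = B_bar K L i 1 K r s \<union> (\<Union>h\<in>{i + 1..K - 2}. B_bar K L h 1 (K - 1) r s)"

definition H_tilde :: "nat \<Rightarrow> nat \<Rightarrow> nat \<Rightarrow> nat \<Rightarrow> nat \<Rightarrow> config set" where
  "H_tilde K L i r s =
     B_tilde K L i 1 K r s \<union> (\<Union>h\<in>{i + 1..K - 2}. B_tilde K L h 1 (K - 1) r s)"

text \<open>For \<open>2 \<le> j \<le> L - 3\<close> and \<open>1 \<le> h \<le> K - 1\<close> this set is also
  \<open>B_tilde K L (K - h) (L - j - 1) K r s\<close>, as seen by looking at the complementary region.\<close>

definition W_set :: "nat \<Rightarrow> nat \<Rightarrow> nat \<Rightarrow> nat \<Rightarrow> nat \<Rightarrow> nat \<Rightarrow> config set" where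
  "W_set K L j h r s = B_bar K L h j K r s"

end

theory Submission
  imports Defs
begin

text \<open>Fix the starting spin \<open>r\<close> and record of a configuration only the set \<open>U\<close> of vertices whose spin is
not \<open>r\<close>. Passing to \<open>U\<close> turns a path of configurations into a path of vertex sets that changes at
most one cell per step, leads from the empty set to the whole torus, and has no more disagreeing
edges than the configuration (\<open>perimeter_supp_le\<close>). If \<open>U\<close> has as many disagreeing edges as the
configuration, then adjacent cells of \<open>U\<close> carry the same spin; when \<open>U\<close> is connected, the configuration has
therefore only two spins. The critical sets below all have perimeter \<open>2 K + 2\<close>, the largest value that
an optimal path can afford, and are connected, as are their complements. So the Potts statement
follows from an Ising statement about vertex sets (\<open>minimal_gate_if_set_gate\<close>), and taking
complements gives the gates with exchanged spins (\<open>set_gate_compl\<close>).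

For vertex sets of perimeter at most \<open>2 K + 2\<close> everything rests on one count: a row or column that
is cut, that is, neither empty nor full, contributes at least \<open>2\<close> to the perimeter. If no row is constant, then
the rows alone use up \<open>2 K\<close>, so at most one column is not constant, and the set is a vertical band
of full columns with at most one bar attached (\<open>strip_is_band_with_bar\<close>). A path from the empty
set to the torus starts among the sets with an empty row, and it can leave them only into the
bands of width one with a bar, by filling the last empty row (\<open>sparse_step\<close>, \<open>strip_entry\<close>).
Within the bands the number of cells changes by at most one per step, so the path meets every size up to the
widths where the bands end, and the size determines the width and the bar. This
gives the families \<open>P\<close> and \<open>W\<close>. For \<open>Q\<close> and \<open>H\<close> the path may enter the bands beyond
the critical size; then the set just before the entry is a column without one cell with a bar next
to it, and either it belongs to the gate or it is the rectangle of two columns and \<open>K - 1\<close> rows. For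
\<open>Q\<close> this rectangle belongs to the gate, and for \<open>H\<close> one looks further back, at the step by which
the path reaches the sets with a single empty row and at least \<open>2 K - 3\<close> cells
(\<open>wide_sparse_two_columns\<close>).

Minimality asks, for every member \<open>U\<close> of a gate, for a path that meets the gate in \<open>U\<close> only. Paths
that add cells one by one achieve this: if all members have the same number of cells, any such path
through \<open>U\<close> will do. For \<open>H\<close>, whose members have different sizes, a member with an empty row is
reached by adding an end of its longer column last, so that all earlier sets have two empty rows.\<close>

section \<open>Cyclic intervals\<close>

definition arc :: "nat \<Rightarrow> nat \<Rightarrow> nat \<Rightarrow> nat set" where
  "arc N s m = (\<lambda>k. (s + k) mod N) ` {..<m}"

definition turns :: "nat \<Rightarrow> nat set \<Rightarrow> nat" where
  "turns N X = card {i. i < N \<and> (i \<in> X) \<noteq> (Suc i mod N \<in> X)}"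

definition mixed :: "nat \<Rightarrow> nat set \<Rightarrow> bool" where
  "mixed N X \<longleftrightarrow> (\<exists>i<N. i \<in> X) \<and> (\<exists>i<N. i \<notin> X)"

lemma arc_0 [simp]: "arc N s 0 = {}"
  by (simp add: arc_def)

lemma arc_Suc: "arc N s (Suc m) = insert ((s + m) mod N) (arc N s m)"
  by (simp add: arc_def lessThan_Suc)

lemma arc_1: "arc N s (Suc 0) = {s mod N}"
  by (simp add: arc_Suc)

lemma arc_mod: "arc N (s mod N) m = arc N s m"
  by (simp add: arc_def mod_add_left_eq)

lemma arc_subset: "0 < N \<Longrightarrow> arc N s m \<subseteq> {..<N}"
  by (auto simp: arc_def)

lemma finite_arc [simp]: "finite (arc N s m)"
  by (simp add: arc_def)

lemma inj_on_shift_mod: "inj_on (\<lambda>k. (s + k) mod N) {..<N::nat}"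
proof (rule inj_onI)
  have *: "a = b" if "a \<le> b" "b < N" "(s + b) mod N = (s + a) mod N" for a b
  proof -
    have "N dvd b - a" using that by (subst (asm) mod_eq_dvd_iff_nat) auto
    then show ?thesis using that by (auto dest!: dvd_imp_le)
  qed
  fix a b assume "a \<in> {..<N}" "b \<in> {..<N}" "(s + a) mod N = (s + b) mod N"
  then show "a = b" using *[of a b] *[of b a] by (cases "a \<le> b") auto
qed

lemma mem_arc_iff:
  assumes "k < N" "m \<le> N"
  shows "(s + k) mod N \<in> arc N s m \<longleftrightarrow> k < m"
  unfolding arc_def using inj_on_image_mem_iff[OF inj_on_shift_mod[of s N], of k "{..<m}"] assms by auto

lemma shift_mod_surj:
  assumes "i < (N::nat)"
  obtains k where "k < N" "i = (s + k) mod N"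
proof
  have "N > 0" using assms by simp
  show "(i + (N - s mod N)) mod N < N" using assms by simp
  have "(s + (i + (N - s mod N))) mod N = (s mod N + (i + (N - s mod N))) mod N"
    by (simp add: mod_add_left_eq)
  also have "s mod N + (i + (N - s mod N)) = i + N"
    using mod_less_divisor[OF \<open>N > 0\<close>, of s] by simp
  also have "(i + N) mod N = i" using assms by simp
  finally show "i = (s + (i + (N - s mod N)) mod N) mod N"
    by (simp add: mod_add_right_eq)
qed

lemma card_arc: "m \<le> N \<Longrightarrow> card (arc N s m) = m"
  unfolding arc_def by (subst card_image) (auto intro: inj_on_subset[OF inj_on_shift_mod])

lemma arc_full: "0 < N \<Longrightarrow> arc N s N = {..<N}"
  by (intro card_subset_eq arc_subset) (simp_all add: card_arc)

lemma compl_arc: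
  assumes "0 < N" "m \<le> N"
  shows "{..<N} - arc N s m = arc N (s + m) (N - m)"
proof -
  have "arc N s N = arc N s m \<union> arc N (s + m) (N - m)"
  proof -
    have "{..<N} = {..<m} \<union> (+) m ` {..<N - m}"
    proof -
      have "k \<in> (+) m ` {..<N - m}" if "k < N" "m \<le> k" for k
        using that by (intro image_eqI[of _ _ "k - m"]) auto
      then show ?thesis using assms by (auto simp: not_less simp del: image_add_atLeastLessThan) (meson not_less)
    qed
    then show ?thesis by (simp add: arc_def image_Un image_image add.assoc)
  qed
  moreover have "arc N s m \<inter> arc N (s + m) (N - m) = {}"
  proof -
    have "(s + m + k) mod N \<notin> arc N s m" if "k < N - m" for k
      using mem_arc_iff[of "m + k" N m s] that assms by (simp add: add.assoc)
    then show ?thesis by (auto simp: arc_def[of N "s + m"])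
  qed
  ultimately show ?thesis using arc_full[OF assms(1)] by blast
qed

lemma insert_left_arc:
  assumes "0 < N"
  shows "insert ((s + N - 1) mod N) (arc N s m) = arc N (s + N - 1) (Suc m)"
proof -
  have "{..<Suc m} = insert 0 (Suc ` {..<m})" by (auto simp: image_iff less_Suc_eq_0_disj)
  moreover have "(s + N - 1 + Suc k) mod N = (s + k) mod N" for k
  proof -
    have "s + N - 1 + Suc k = (s + k) + N" using assms by simp
    then show ?thesis by (simp only: mod_add_self2)
  qed
  ultimately show ?thesis by (simp add: arc_def image_image)
qed

lemma arc_minus_1:
  assumes "e < N"
  shows "{..<N} - {e} = arc N (Suc e) (N - 1)"
  using compl_arc[of N 1 e] assms by (simp add: arc_Suc)

lemma turns_cong: "X \<inter> {..<N} = Y \<inter> {..<N} \<Longrightarrow> turns N X = turns N Y"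
proof -
  assume "X \<inter> {..<N} = Y \<inter> {..<N}"
  then have "i \<in> X \<longleftrightarrow> i \<in> Y" if "i < N" for i using that by blast
  then have "{i. i < N \<and> (i \<in> X) \<noteq> (Suc i mod N \<in> X)} = {i. i < N \<and> (i \<in> Y) \<noteq> (Suc i mod N \<in> Y)}" by auto
  then show ?thesis by (simp add: turns_def)
qed

lemma turns_compl: "turns N ({..<N} - X) = turns N X"
  unfolding turns_def by (rule arg_cong[where f = card]) auto

lemma turns_not_mixed: "\<not> mixed N X \<Longrightarrow> turns N X = 0"
  unfolding turns_def mixed_def by (auto simp: card_eq_0_iff)

lemma exit_exists:
  assumes "0 < (N::nat)" "i < N" "i \<in> X" "(i + k) mod N \<notin> X"
  shows "\<exists>p<N. p \<in> X \<and> Suc p mod N \<notin> X"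
  using assms(4)
proof (induction k)
  case (Suc k)
  show ?case
  proof (cases "(i + k) mod N \<in> X")
    case True
    have "Suc ((i + k) mod N) mod N = (i + Suc k) mod N" by (simp add: mod_Suc_eq)
    then show ?thesis using True Suc.prems assms(1) by (metis mod_less_divisor)
  qed (use Suc in auto)
qed (use assms in auto)

lemma mixed_has_exit:
  assumes "mixed N X" shows "\<exists>p<N. p \<in> X \<and> Suc p mod N \<notin> X"
proof -
  obtain a b where "a < N" "a \<in> X" "b < N" "b \<notin> X" using assms by (auto simp: mixed_def)
  moreover obtain k where "b = (a + k) mod N" using shift_mod_surj \<open>b < N\<close> by blast
  ultimately show ?thesis using exit_exists[of N a X k] by simp
qed

lemma mixed_has_entry:
  assumes "mixed N X" shows "\<exists>p<N. p \<notin> X \<and> Suc p mod N \<in> X"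
  using mixed_has_exit[of N "- X"] assms by (auto simp: mixed_def)

text \<open>A cyclic sequence that is not constant has to leave its set and to come back to it.\<close>

lemma turns_mixed_ge_2:
  assumes "mixed N X" shows "2 \<le> turns N X"
proof -
  obtain p p' where p: "p < N" "p \<in> X" "Suc p mod N \<notin> X" "p' < N" "p' \<notin> X" "Suc p' mod N \<in> X"
    using mixed_has_exit[OF assms] mixed_has_entry[OF assms] by blast
  then have "{p, p'} \<subseteq> {i. i < N \<and> (i \<in> X) \<noteq> (Suc i mod N \<in> X)}" by auto
  then have "card {p, p'} \<le> turns N X" unfolding turns_def by (intro card_mono) auto
  moreover have "p \<noteq> p'" using p by auto
  ultimately show ?thesis by simp
qed

lemma turns_arc_le_2:
  assumes "m \<le> N" shows "turns N (arc N s m) \<le> 2"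
proof -
  have "{i. i < N \<and> (i \<in> arc N s m) \<noteq> (Suc i mod N \<in> arc N s m)}
    \<subseteq> (\<lambda>k. (s + k) mod N) ` {m - 1, N - 1}" (is "?T \<subseteq> _")
  proof
    fix i assume "i \<in> ?T"
    then have i: "i < N" "(i \<in> arc N s m) \<noteq> (Suc i mod N \<in> arc N s m)" by auto
    obtain k where k: "k < N" "i = (s + k) mod N" using shift_mod_surj i(1) by blast
    have S: "Suc i mod N = (s + Suc k) mod N" using k by (simp add: mod_Suc_eq)
    have "k = m - 1 \<or> k = N - 1"
    proof (rule ccontr)
      assume *: "\<not> (k = m - 1 \<or> k = N - 1)"
      then have "Suc k < N" using k by auto
      then have "Suc k < m \<longleftrightarrow> Suc i mod N \<in> arc N s m" unfolding S
        using mem_arc_iff[of "Suc k" N m s] assms by simp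
      moreover have "k < m \<longleftrightarrow> i \<in> arc N s m" using k assms by (simp add: mem_arc_iff)
      ultimately show False using i(2) * by auto
    qed
    then show "i \<in> (\<lambda>k. (s + k) mod N) ` {m - 1, N - 1}" using k by auto
  qed
  then have "turns N (arc N s m) \<le> card ((\<lambda>k. (s + k) mod N) ` {m - 1, N - 1})"
    unfolding turns_def by (intro card_mono) auto
  also have "\<dots> \<le> card {m - 1, N - 1}" by (rule card_image_le) simp
  also have "\<dots> \<le> 2" by (simp add: card_insert_if)
  finally show ?thesis .
qed

text \<open>With only two turns there is a single entry into \<open>X\<close> and a single exit, so \<open>X\<close> is the stretch
  between them. The arc starts right after the entry and its length is the first time at which the set is left.\<close>

lemma arc_if_turns_le_2:
  assumes mix: "mixed N X" and X: "X \<subseteq> {..<N}" and t: "turns N X \<le> 2"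
  obtains s m where "s < N" "1 \<le> m" "m < N" "X = arc N s m"
proof -
  let ?T = "{i. i < N \<and> (i \<in> X) \<noteq> (Suc i mod N \<in> X)}"
  obtain p where p: "p < N" "p \<notin> X" "Suc p mod N \<in> X" using mixed_has_entry[OF mix] by blast
  obtain x where x: "x < N" "x \<in> X" "Suc x mod N \<notin> X" using mixed_has_exit[OF mix] by blast
  have entry_unique: "p' = p" if "p' < N" "p' \<notin> X" "Suc p' mod N \<in> X" for p'
  proof (rule ccontr)
    assume "p' \<noteq> p"
    moreover have "x \<noteq> p" "x \<noteq> p'" using x p that by auto
    ultimately have "card {p, p', x} = 3" by simp
    moreover have "card {p, p', x} \<le> card ?T" using p x that by (intro card_mono) auto
    ultimately show False using t by (simp add: turns_def)
  qed
  define s where "s = Suc p mod N"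
  define m where "m = (LEAST k. (s + k) mod N \<notin> X)"
  have s: "s < N" "s \<in> X" using p by (auto simp: s_def)
  obtain k where k: "k < N" "p = (s + k) mod N" using shift_mod_surj p(1) by blast
  have sN: "(s + (N - 1)) mod N = p"
  proof -
    have "(s + (N - 1)) mod N = (Suc p + (N - 1)) mod N" by (simp add: s_def mod_add_left_eq)
    also have "Suc p + (N - 1) = p + N" using p by simp
    finally show ?thesis using p by simp
  qed
  have m1: "(s + m) mod N \<notin> X" unfolding m_def by (rule LeastI[of _ k]) (use k p in simp)
  have m2: "(s + l) mod N \<in> X" if "l < m" for l using not_less_Least that unfolding m_def by blast
  have mN: "m \<le> N - 1" unfolding m_def by (rule Least_le) (use sN p in simp)
  have out: "(s + l) mod N \<notin> X" if "m \<le> l" "l < N" for l using that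
  proof (induction l rule: dec_induct)
    case base then show ?case using m1 by simp
  next
    case (step l)
    have S: "Suc ((s + l) mod N) mod N = (s + Suc l) mod N" by (simp add: mod_Suc_eq)
    show ?case
    proof
      assume "(s + Suc l) mod N \<in> X"
      then have "(s + l) mod N = p" using step S entry_unique[of "(s + l) mod N"] p(1) by auto
      then have "(s + l) mod N = (s + (N - 1)) mod N" using sN by simp
      then have "l = N - 1" using inj_onD[OF inj_on_shift_mod[of s N], of l "N - 1"] step p(1) by simp
      then show False using step by simp
    qed
  qed
  have "X = arc N s m"
  proof
    show "arc N s m \<subseteq> X" using m2 by (auto simp: arc_def)
    show "X \<subseteq> arc N s m"
    proof
      fix i assume i: "i \<in> X"
      obtain l where "l < N" "i = (s + l) mod N" using shift_mod_surj i X by blast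
      then have "l < m" using out[of l] i by (meson not_le)
      then show "i \<in> arc N s m" using \<open>i = _\<close> by (auto simp: arc_def)
    qed
  qed
  moreover have "m \<noteq> 0" using m1 s by (metis add_0_right mod_less)
  ultimately show ?thesis using that[of s m] s mN p(1) by simp
qed

text \<open>A point that is added elsewhere than at an end of the arc creates a second exit.\<close>

lemma arc_extend:
  assumes "s < N" "1 \<le> m" "c < N" "c \<notin> arc N s m" "m < N"
    and t: "turns N (insert c (arc N s m)) \<le> 2" and mix: "mixed N (insert c (arc N s m))"
  shows "c = (s + m) mod N \<or> c = (s + N - 1) mod N"
proof (rule ccontr)
  let ?X = "arc N s m" let ?Y = "insert c ?X"
  assume no: "\<not> ?thesis"
  have N: "N > 0" using assms by simp
  obtain k where k: "k < N" "c = (s + k) mod N" using shift_mod_surj assms(3) by blast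
  have km: "m \<le> k" using k assms(4,5) mem_arc_iff[of k N m s] by auto
  have "k \<noteq> m" using no k by auto
  moreover have "k \<noteq> N - 1" using no k N by auto
  ultimately have kk: "m < k" "Suc k < N" using km k by auto
  have sub: "?Y \<subseteq> {..<N}" using arc_subset[OF N] assms(3) by auto
  let ?a = "(s + (m - 1)) mod N"
  have a: "?a \<in> ?Y" "Suc ?a mod N \<notin> ?Y"
  proof -
    show "?a \<in> ?Y" using assms mem_arc_iff[of "m - 1" N m s] by simp
    have "Suc ?a mod N = (s + m) mod N" using assms(2) by (simp add: mod_Suc_eq)
    then show "Suc ?a mod N \<notin> ?Y" using no assms mem_arc_iff[of m N m s] by auto
  qed
  have c: "Suc c mod N \<notin> ?Y"
  proof -
    have "Suc c mod N = (s + Suc k) mod N" using k by (simp add: mod_Suc_eq)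
    moreover have "(s + Suc k) mod N \<noteq> c" using inj_onD[OF inj_on_shift_mod[of s N], of "Suc k" k] kk k by auto
    ultimately show ?thesis using kk assms mem_arc_iff[of "Suc k" N m s] by auto
  qed
  have "?a \<noteq> c" using assms mem_arc_iff[of "m - 1" N m s] by auto
  obtain p where p: "p < N" "p \<notin> ?Y" "Suc p mod N \<in> ?Y" using mixed_has_entry[OF mix] by blast
  have "card {?a, c, p} \<le> turns N ?Y" unfolding turns_def
    using a c p assms(3) N by (intro card_mono) auto
  moreover have "card {?a, c, p} = 3" using \<open>?a \<noteq> c\<close> p(2) a by (auto simp: card_insert_if)
  ultimately show False using t by simp
qed

text \<open>The offset \<open>d\<close> is counted from the avoided point, as needed for bars next to a column with one
  missing cell.\<close>

lemma arc_avoiding: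
  assumes "e < N" "e \<notin> arc N s h" "h \<le> N" "1 \<le> h"
  obtains d where "d + h \<le> N - 1" "arc N s h = arc N (Suc e + d) h"
proof -
  have N: "N > 0" using assms by simp
  obtain d where d: "d < N" "s mod N = (Suc e + d) mod N"
    using shift_mod_surj[of "s mod N" N "Suc e"] N by auto
  have eq: "arc N s h = arc N (Suc e + d) h" using d(2) by (metis arc_mod)
  have "d + h \<le> N - 1"
  proof (rule ccontr)
    assume "\<not> ?thesis"
    then have "N - 1 - d < h" using d by auto
    then have "(Suc e + d + (N - 1 - d)) mod N \<in> arc N (Suc e + d) h" by (auto simp: arc_def)
    moreover have "Suc e + d + (N - 1 - d) = e + N" using d by simp
    ultimately show False using eq assms by simp
  qed
  then show ?thesis using that eq by blast
qed

lemma const_on_arc: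
  assumes "0 < N" "m \<le> N"
    and f: "\<And>x. x \<in> arc N s m \<Longrightarrow> Suc x mod N \<in> arc N s m \<Longrightarrow> f x = f (Suc x mod N)"
    and xy: "x \<in> arc N s m" "y \<in> arc N s m"
  shows "f x = f y"
proof -
  have "f ((s + k) mod N) = f ((s + 0) mod N)" if "k < m" for k
    using that
  proof (induction k)
    case (Suc k)
    have S: "Suc ((s + k) mod N) mod N = (s + Suc k) mod N" by (simp add: mod_Suc_eq)
    have "(s + k) mod N \<in> arc N s m" "(s + Suc k) mod N \<in> arc N s m"
      using Suc.prems by (auto simp: arc_def simp del: add_Suc_right)
    then have "f ((s + k) mod N) = f ((s + Suc k) mod N)" using f[of "(s + k) mod N"] S by simp
    then show ?case using Suc by simp
  qed simp
  then have "f x = f ((s + 0) mod N)" if "x \<in> arc N s m" for x using that by (auto simp: arc_def)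
  then show ?thesis using xy by metis
qed

text \<open>A set with at most two turns is connected in the cycle.\<close>

lemma const_if_turns_le_2:
  assumes "0 < N" "X \<subseteq> {..<N}" "turns N X \<le> 2"
    and f: "\<And>x. x \<in> X \<Longrightarrow> Suc x mod N \<in> X \<Longrightarrow> f x = f (Suc x mod N)"
    and xy: "x \<in> X" "y \<in> X"
  shows "f x = f y"
proof -
  have "\<exists>s m. m \<le> N \<and> X = arc N s m"
  proof (cases "mixed N X")
    case True
    then show ?thesis using arc_if_turns_le_2[OF True assms(2,3)] by (metis less_imp_le)
  next
    case False
    then have "X = {..<N}" using xy assms(2) unfolding mixed_def by blast
    then show ?thesis using arc_full[OF assms(1), of 0] by auto
  qed
  then obtain s m where "m \<le> N" "X = arc N s m" by blast
  then show ?thesis using const_on_arc[OF assms(1), of m s f x y] f xy by auto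
qed

section \<open>Perimeters of vertex sets\<close>

abbreviation row :: "vertex set \<Rightarrow> nat \<Rightarrow> nat set" where
  "row U i \<equiv> {j. (i, j) \<in> U}"

abbreviation col :: "vertex set \<Rightarrow> nat \<Rightarrow> nat set" where
  "col U j \<equiv> {i. (i, j) \<in> U}"

locale torus =
  fixes K L :: nat
  assumes K_ge_3: "3 \<le> K" and K_less_L: "K < L"
begin

abbreviation V :: "vertex set" where "V \<equiv> vertices K L"

text \<open>The perimeter counts the edges of the torus between \<open>U\<close> and its complement, horizontal ones row by row and
  vertical ones column by column.\<close>

definition perimeter :: "vertex set \<Rightarrow> nat" where
  "perimeter U = (\<Sum>i<K. turns L (row U i)) + (\<Sum>j<L. turns K (col U j))"

lemma pos [simp]: "0 < K" "0 < L" using K_ge_3 K_less_L by auto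

lemma mem_V: "(i, j) \<in> V \<longleftrightarrow> i < K \<and> j < L" by (auto simp: vertices_def)

lemma finite_V [simp]: "finite V" by (simp add: vertices_def)

lemma finite_sub: "U \<subseteq> V \<Longrightarrow> finite U" using finite_V finite_subset by blast

lemma card_V: "card V = K * L" by (simp add: vertices_def)

text \<open>This symmetry turns gates with an \<open>s\<close>-droplet in the sea of \<open>r\<close> into gates with the spins exchanged.\<close>

lemma perimeter_compl: "perimeter (V - U) = perimeter U"
proof -
  have "turns L (row (V - U) i) = turns L (row U i)" if "i < K" for i
    by (subst turns_compl[symmetric, of _ "row U i"], rule turns_cong) (auto simp: mem_V that)
  moreover have "turns K (col (V - U) j) = turns K (col U j)" if "j < L" for j
    by (subst turns_compl[symmetric, of _ "col U j"], rule turns_cong) (auto simp: mem_V that)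
  ultimately show ?thesis by (simp add: perimeter_def)
qed

lemma twice_card_le_sum:
  fixes f :: "nat \<Rightarrow> nat"
  assumes "I \<subseteq> {..<n}" "\<And>i. i \<in> I \<Longrightarrow> 2 \<le> f i"
  shows "2 * card I \<le> (\<Sum>i<n. f i)"
proof -
  have "2 * card I = (\<Sum>i\<in>I. 2)" by simp
  also have "\<dots> \<le> (\<Sum>i\<in>I. f i)" by (intro sum_mono assms)
  also have "\<dots> \<le> (\<Sum>i<n. f i)" by (intro sum_mono2 assms) auto
  finally show ?thesis .
qed

lemma rows_ge: "I \<subseteq> {..<K} \<Longrightarrow> (\<And>i. i \<in> I \<Longrightarrow> mixed L (row U i)) \<Longrightarrow>
    2 * card I \<le> (\<Sum>i<K. turns L (row U i))"
  by (rule twice_card_le_sum) (auto intro: turns_mixed_ge_2)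

lemma cols_ge: "J \<subseteq> {..<L} \<Longrightarrow> (\<And>j. j \<in> J \<Longrightarrow> mixed K (col U j)) \<Longrightarrow>
    2 * card J \<le> (\<Sum>j<L. turns K (col U j))"
  by (rule twice_card_le_sum) (auto intro: turns_mixed_ge_2)

lemma perimeter_ge:
  assumes "I \<subseteq> {..<K}" "\<And>i. i \<in> I \<Longrightarrow> mixed L (row U i)"
    "J \<subseteq> {..<L}" "\<And>j. j \<in> J \<Longrightarrow> mixed K (col U j)"
  shows "2 * (card I + card J) \<le> perimeter U"
  using rows_ge[OF assms(1,2)] cols_ge[OF assms(3,4)] by (simp add: perimeter_def)

text \<open>All slices are intervals. For such sets the perimeter is at most twice the number of
  slices that are not constant, which bounds the energy along the constructed paths.\<close>

definition ortho :: "vertex set \<Rightarrow> bool" where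
  "ortho U \<longleftrightarrow> U \<subseteq> V \<and> (\<forall>i<K. turns L (row U i) \<le> 2) \<and> (\<forall>j<L. turns K (col U j) \<le> 2)"

lemma sum_le_twice_card:
  fixes f :: "nat \<Rightarrow> nat"
  assumes "finite I" "\<And>i. i < n \<Longrightarrow> f i \<le> 2" "\<And>i. i < n \<Longrightarrow> i \<notin> I \<Longrightarrow> f i = 0"
  shows "(\<Sum>i<n. f i) \<le> 2 * card I"
proof -
  have "(\<Sum>i<n. f i) = (\<Sum>i\<in>I \<inter> {..<n}. f i)"
    using assms(3) by (intro sum.mono_neutral_right) (auto, fastforce)
  also have "\<dots> \<le> (\<Sum>i\<in>I \<inter> {..<n}. 2)" by (intro sum_mono) (use assms in auto)
  also have "\<dots> \<le> 2 * card I" using assms(1) by (auto intro: card_mono)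
  finally show ?thesis .
qed

lemma perimeter_le:
  assumes "ortho U" "finite I" "finite J"
    "\<And>i. i < K \<Longrightarrow> i \<notin> I \<Longrightarrow> \<not> mixed L (row U i)"
    "\<And>j. j < L \<Longrightarrow> j \<notin> J \<Longrightarrow> \<not> mixed K (col U j)"
  shows "perimeter U \<le> 2 * (card I + card J)"
proof -
  have "(\<Sum>i<K. turns L (row U i)) \<le> 2 * card I"
    using assms by (intro sum_le_twice_card) (auto simp: ortho_def turns_not_mixed)
  moreover have "(\<Sum>j<L. turns K (col U j)) \<le> 2 * card J"
    using assms by (intro sum_le_twice_card) (auto simp: ortho_def turns_not_mixed)
  ultimately show ?thesis by (simp add: perimeter_def)
qed

lemma row_subset: "U \<subseteq> V \<Longrightarrow> row U i \<subseteq> {..<L}" by (auto simp: vertices_def)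

lemma col_subset: "U \<subseteq> V \<Longrightarrow> col U j \<subseteq> {..<K}" by (auto simp: vertices_def)

section \<open>Sets that cut every row\<close>

definition band :: "nat \<Rightarrow> nat \<Rightarrow> vertex set" where
  "band s j = {..<K} \<times> arc L s j"

abbreviation bar :: "nat \<Rightarrow> nat \<Rightarrow> nat \<Rightarrow> vertex set" where
  "bar c t h \<equiv> arc K t h \<times> {c}"

lemma band_bar_sub: "c < L \<Longrightarrow> band s j \<union> bar c t h \<subseteq> V"
  using arc_subset[of L s j] arc_subset[of K t h] by (auto simp: band_def vertices_def)

text \<open>The sets between droplets and their complements: every row is cut.\<close>

definition strip :: "vertex set \<Rightarrow> bool" where
  "strip U \<longleftrightarrow> U \<subseteq> V \<and> perimeter U \<le> 2 * K + 2 \<and> (\<forall>i<K. mixed L (row U i))"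

text \<open>The rows use up \<open>2 K\<close> of the perimeter. If all columns are constant, all rows agree, and a row with
  more than two turns would cost at least \<open>3 K > 2 K + 2\<close>. Otherwise a single column is not constant, and it uses up
  the remaining \<open>2\<close>; then all rows have exactly two turns, and comparing a row in which the exceptional
  column is occupied with one in which it is not shows that this column is next to the band.\<close>

lemma strip_is_band_with_bar:
  assumes "strip U"
  obtains s j t h c where "s < L" "1 \<le> j" "j < L" "t < K" "h < K" "1 \<le> h \<Longrightarrow> Suc j < L"
    "c = (s + j) mod L \<or> c = (s + L - 1) mod L" "c \<notin> arc L s j"
    "U = band s j \<union> bar c t h"
proof -
  have U: "U \<subseteq> V" and perimeter: "perimeter U \<le> 2 * K + 2" and mix: "\<And>i. i < K \<Longrightarrow> mixed L (row U i)"
    using assms by (auto simp: strip_def)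
  have row_sub: "row U i \<subseteq> {..<L}" for i using U by (auto simp: vertices_def)
  have rows: "2 * K \<le> (\<Sum>i<K. turns L (row U i))"
    using rows_ge[of "{..<K}" U] mix by simp
  show ?thesis
  proof (cases "\<exists>c<L. mixed K (col U c)")
    case False
    have same: "row U i = row U 0" if "i < K" for i
    proof -
      have "(i, j) \<in> U \<longleftrightarrow> (0, j) \<in> U" for j
      proof (cases "j < L")
        case True then show ?thesis using False that unfolding mixed_def using pos(1) by blast
      qed (use U in \<open>auto simp: vertices_def\<close>)
      then show ?thesis by auto
    qed
    have "(\<Sum>i<K. turns L (row U i)) = (\<Sum>i<K. turns L (row U 0))"
      by (rule sum.cong[OF refl], rule arg_cong[OF same]) simp
    then have "K * turns L (row U 0) = (\<Sum>i<K. turns L (row U i))" by simp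
    also have "\<dots> \<le> 2 * K + 2" using perimeter by (simp add: perimeter_def)
    finally have "K * turns L (row U 0) \<le> 2 * K + 2" .
    moreover have "K * 3 \<le> K * turns L (row U 0)" if "3 \<le> turns L (row U 0)"
      using that by simp
    ultimately have "\<not> 3 \<le> turns L (row U 0)" using K_ge_3 by linarith
    then have "turns L (row U 0) \<le> 2" by simp
    then obtain s m where s: "s < L" "1 \<le> m" "m < L" "row U 0 = arc L s m"
      using arc_if_turns_le_2[OF mix[of 0] row_sub] by auto
    have "(i, y) \<in> U \<longleftrightarrow> (i, y) \<in> band s m" for i y
    proof (cases "i < K")
      case True
      then show ?thesis using same[OF True] s(4) by (auto simp: band_def)
    qed (use U in \<open>auto simp: band_def vertices_def\<close>)
    then have "U = band s m \<union> bar ((s + m) mod L) 0 0" by auto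
    moreover have "(s + m) mod L \<notin> arc L s m" using mem_arc_iff[of m L m s] s by simp
    ultimately show ?thesis using that[of s m 0 0 "(s + m) mod L"] s by simp
  next
    case True
    then obtain c where c: "c < L" "mixed K (col U c)" by blast
    have sc: "(\<Sum>j<L. turns K (col U j)) \<le> 2" using rows perimeter by (simp add: perimeter_def)
    have "turns K (col U c) \<le> (\<Sum>j<L. turns K (col U j))"
      by (rule member_le_sum) (use c in auto)
    then have tc: "turns K (col U c) \<le> 2" using sc by simp
    have only: "\<not> mixed K (col U y)" if "y < L" "y \<noteq> c" for y
      using cols_ge[of "{y, c}" U] that c sc by auto
    have sr: "(\<Sum>i<K. turns L (row U i)) \<le> 2 * K"
      using perimeter cols_ge[of "{c}" U] c by (simp add: perimeter_def)
    have tr: "turns L (row U i) \<le> 2" if "i < K" for i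
    proof (rule ccontr)
      assume "\<not> ?thesis"
      then have "(\<Sum>i<K. 2) < (\<Sum>i<K. turns L (row U i))"
        using that mix by (intro sum_strict_mono_ex1) (auto intro!: turns_mixed_ge_2 bexI[of _ i])
      then show False using sr by simp
    qed
    obtain t h where th: "t < K" "1 \<le> h" "h < K" "col U c = arc K t h"
      using arc_if_turns_le_2[OF c(2) col_subset[OF U] tc] by metis
    obtain a b where ab: "a < K" "(a, c) \<in> U" "b < K" "(b, c) \<notin> U"
      using c(2) by (auto simp: mixed_def)
    obtain s m where s: "s < L" "1 \<le> m" "m < L" "row U b = arc L s m"
      using arc_if_turns_le_2[OF mix[OF ab(3)] row_sub tr[OF ab(3)]] by auto
    have same: "(i, y) \<in> U \<longleftrightarrow> y \<in> arc L s m" if "i < K" "y \<noteq> c" for i y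
    proof -
      have "(i, y) \<in> U \<longleftrightarrow> (b, y) \<in> U"
      proof (cases "y < L")
        case True then show ?thesis using only[of y] ab that unfolding mixed_def by blast
      qed (use U in \<open>auto simp: vertices_def\<close>)
      then show ?thesis using s(4) by auto
    qed
    have cn: "c \<notin> arc L s m" using ab s(4) by auto
    have "(a, y) \<in> U \<longleftrightarrow> y \<in> insert c (arc L s m)" for y
      using same[of a y] ab by (cases "y = c") auto
    then have ra: "row U a = insert c (arc L s m)" by blast
    have "c = (s + m) mod L \<or> c = (s + L - 1) mod L"
      using tr[OF ab(1)] mix[OF ab(1)] s c cn unfolding ra by (intro arc_extend) auto
    moreover have "Suc m < L"
    proof -
      have "card (insert c (arc L s m)) < card {..<L}"
        using mix[OF ab(1)] row_sub[of a] unfolding ra mixed_def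
        by (intro psubset_card_mono) auto
      then show ?thesis using cn s card_arc[of m L s] by simp
    qed
    moreover have "U = band s m \<union> bar c t h"
    proof -
      have "(i, y) \<in> U \<longleftrightarrow> (i, y) \<in> band s m \<union> bar c t h" for i y
      proof (cases "i < K")
        case True
        then show ?thesis using same[of i y] th(4) cn by (cases "y = c") (auto simp: band_def)
      next
        case False
        then show ?thesis using U arc_subset[of K t h] by (auto simp: band_def vertices_def)
      qed
      then show ?thesis by auto
    qed
    ultimately show ?thesis using that[of s m t h c] s th cn by auto
  qed
qed

lemma card_band_bar:
  assumes "j \<le> L" "h \<le> K" "c \<notin> arc L s j"
  shows "card (band s j \<union> bar c t h) = K * j + h"
proof -
  have "card (band s j \<union> bar c t h) = card (band s j) + card (bar c t h)"
    using assms by (intro card_Un_disjoint) (auto simp: band_def)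
  then show ?thesis using assms by (simp add: band_def card_cartesian_product card_arc)
qed

section \<open>Leaving the sparse sets\<close>

definition low :: "vertex set \<Rightarrow> bool" where
  "low U \<longleftrightarrow> U \<subseteq> V \<and> perimeter U \<le> 2 * K + 2"

definition step :: "vertex set \<Rightarrow> vertex set \<Rightarrow> bool" where
  "step U U' \<longleftrightarrow> (\<exists>x\<in>V. U - {x} = U' - {x})"

lemma step_sym: "step U U' \<Longrightarrow> step U' U" by (auto simp: step_def)

lemma step_card:
  assumes "step U U'" "finite U" shows "card U' \<le> Suc (card U)"
proof -
  obtain x where x: "U - {x} = U' - {x}" using assms(1) by (auto simp: step_def)
  have "U' \<subseteq> insert x U" using x by blast
  then have "card U' \<le> card (insert x U)" using assms(2) by (intro card_mono) auto
  then show ?thesis using card_insert_le_m1[of "Suc (card U)" U x] assms(2) by (simp add: card_insert_if split: if_splits)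
qed

text \<open>The droplets. For \<open>L = K + 1\<close> a single full row has perimeter \<open>2 L = 2 K + 2\<close>, so a path
  can pass through it, although it cannot go on from there except back to smaller droplets. Admitting one full row keeps
  such excursions inside the class.\<close>

definition sparse :: "vertex set \<Rightarrow> bool" where
  "sparse U \<longleftrightarrow> (\<exists>i<K. row U i = {}) \<and>
     (\<forall>i<K. \<forall>i'<K. {..<L} \<subseteq> row U i \<longrightarrow> {..<L} \<subseteq> row U i' \<longrightarrow> i = i')"

lemma mixed_row: "U \<subseteq> V \<Longrightarrow> mixed L (row U i) \<longleftrightarrow> row U i \<noteq> {} \<and> \<not> {..<L} \<subseteq> row U i"
  using row_subset[of U i] by (auto simp: mixed_def)

text \<open>An empty row together with a full row forces \<open>2\<close> in each of the \<open>L > K\<close> columns, and nothing is left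
  for the rows.\<close>

lemma no_mixed_row:
  assumes "low U" "a < K" "row U a = {}" "b < K" "{..<L} \<subseteq> row U b" "i < K"
  shows "\<not> mixed L (row U i)"
proof
  assume i: "mixed L (row U i)"
  have "mixed K (col U j)" if "j < L" for j using assms(2-5) that by (auto simp: mixed_def)
  then have "2 * (card {i} + card {..<L}) \<le> perimeter U"
    by (intro perimeter_ge) (use i assms(6) in auto)
  then show False using assms(1) K_less_L by (simp add: low_def)
qed

text \<open>Suppose that the new set is neither sparse nor cut in every row. Either it has two full rows next to an
  empty one; then the old set had an empty row, a full row and, where the change took place, a cut row, against
  \<open>no_mixed_row\<close>. Or its only empty row has just been filled and a full row was there before; then, again by
  \<open>no_mixed_row\<close>, all rows of the old set were constant, and a third row gives a second full row of the old set or an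
  empty row of the new one.\<close>

lemma sparse_step:
  assumes low: "low U" "low U'" and sp: "sparse U" and st: "step U U'"
  shows "sparse U' \<or> strip U'"
proof -
  have sub: "U \<subseteq> V" "U' \<subseteq> V" using low by (auto simp: low_def)
  obtain p y where x: "(p, y) \<in> V" "U - {(p, y)} = U' - {(p, y)}" using st by (auto simp: step_def)
  have same: "row U' i = row U i" if "i \<noteq> p" for i using x(2) that by blast
  have p_diff: "row U p - {y} = row U' p - {y}" using x(2) by blast
  obtain e where e: "e < K" "row U e = {}" using sp by (auto simp: sparse_def)
  have one_full: "i = i'" if "i < K" "i' < K" "{..<L} \<subseteq> row U i" "{..<L} \<subseteq> row U i'" for i i'
    using sp that by (auto simp: sparse_def)
  have L2: "\<exists>z<L. z \<noteq> y" using K_ge_3 K_less_L by (intro exI[of _ "if y = 0 then 1 else 0"]) auto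
  show ?thesis
  proof (cases "\<exists>i<K. row U' i = {}")
    case True
    have "False" if ii: "i < K" "i' < K" "{..<L} \<subseteq> row U' i" "{..<L} \<subseteq> row U' i'" "i \<noteq> i'" "i \<noteq> p" for i i'
    proof -
      have fi: "{..<L} \<subseteq> row U i" using ii same by auto
      have p: "i' = p" using one_full[of i i'] ii same fi by (cases "i' = p") auto
      have nf: "\<not> {..<L} \<subseteq> row U p" using one_full[of i p] ii p fi by auto
      obtain z where "z < L" "z \<noteq> y" using L2 by blast
      then have "z \<in> row U p" using ii(4) p_diff unfolding p by blast
      then have "mixed L (row U p)" using nf mixed_row[OF sub(1)] by auto
      then show False using no_mixed_row[OF low(1) e ii(1) fi, of p] ii(2) p by simp
    qed
    then have "sparse U'" using True unfolding sparse_def by metis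
    then show ?thesis ..
  next
    case False
    have ep: "e = p" using False e same by metis
    have "strip U'"
    proof (rule ccontr)
      assume "\<not> strip U'"
      then obtain f where f: "f < K" "{..<L} \<subseteq> row U' f"
        using low(2) False mixed_row[OF sub(2)] unfolding strip_def low_def by blast
      have "row U' p \<subseteq> {y}" using p_diff e ep by blast
      then have "f \<noteq> p" using f L2 by auto
      then have ff: "{..<L} \<subseteq> row U f" using f same by auto
      obtain g where g: "g < K" "g \<noteq> e" "g \<noteq> f"
      proof -
        define g :: nat where "g = (if 0 \<noteq> e \<and> 0 \<noteq> f then 0 else if 1 \<noteq> e \<and> 1 \<noteq> f then 1 else 2)"
        have "g < K" "g \<noteq> e" "g \<noteq> f" using K_ge_3 by (auto simp: g_def)
        then show ?thesis using that by blast
      qed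
      have "\<not> mixed L (row U g)" using no_mixed_row[OF low(1) e f(1) ff g(1)] .
      then have "row U g = {} \<or> {..<L} \<subseteq> row U g" using mixed_row[OF sub(1)] by auto
      then show False using False g ep same one_full[of f g] f(1) ff by metis
    qed
    then show ?thesis ..
  qed
qed

text \<open>The only other way out of the bands fills up a row, which then must already have contained \<open>L - 1\<close> cells.\<close>

lemma strip_step:
  assumes st: "step U U'" and U: "strip U" and U': "low U'" "\<not> sparse U'" "\<not> strip U'"
  shows "K * (L - 2) \<le> card U"
proof -
  have sub: "U \<subseteq> V" "U' \<subseteq> V" using U U' by (auto simp: low_def strip_def)
  obtain p y where x: "(p, y) \<in> V" "U - {(p, y)} = U' - {(p, y)}" using st by (auto simp: step_def)
  have same: "row U' i = row U i" if "i \<noteq> p" for i using x(2) that by blast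
  have mix: "\<And>i. i < K \<Longrightarrow> mixed L (row U i)" using U by (simp add: strip_def)
  obtain i where i: "i < K" "\<not> mixed L (row U' i)" using U' by (auto simp: strip_def low_def)
  have ip: "i = p" using i mix same by metis
  have not_full: "\<not> {..<L} \<subseteq> row U' a" if "a < K" "a \<noteq> p" for a
    using mix[OF that(1)] same[OF that(2)] mixed_row[OF sub(1)] by auto
  have "row U' p \<noteq> {}"
  proof
    assume "row U' p = {}"
    then have "sparse U'" using not_full i ip unfolding sparse_def by metis
    then show False using U' by simp
  qed
  then have full: "{..<L} \<subseteq> row U' p" using i ip mixed_row[OF sub(2)] by auto
  obtain s j t h c where sc: "s < L" "1 \<le> j" "j < L" "t < K" "h < K" "1 \<le> h \<Longrightarrow> Suc j < L"
    "c = (s + j) mod L \<or> c = (s + L - 1) mod L" "c \<notin> arc L s j" "U = band s j \<union> bar c t h"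
    using strip_is_band_with_bar[OF U] by metis
  have "{..<L} \<subseteq> insert y (insert c (arc L s j))"
    using full x(2) unfolding sc(9) by (auto simp: band_def)
  then have "card {..<L} \<le> card (insert y (insert c (arc L s j)))" by (intro card_mono) auto
  also have "\<dots> \<le> j + 2" using sc(3) by (auto simp: card_insert_if card_arc)
  finally have "L - 2 \<le> j" by simp
  then have "K * (L - 2) \<le> K * j" by (rule mult_le_mono2)
  moreover have "card U = K * j + h" unfolding sc(9) by (rule card_band_bar) (use sc in auto)
  ultimately show ?thesis by linarith
qed

text \<open>The changed cell lies in the row that was empty before. So this row has a single cell afterwards, which
  forces a band of one column and a bar that avoids this row.\<close>

lemma strip_entry:
  assumes sp: "sparse U" and U': "strip U'" and st: "step U U'" and sub: "U \<subseteq> V"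
  obtains s t h c e where "s < L" "t < K" "h < K" "e < K"
    "c = Suc s mod L \<or> c = (s + L - 1) mod L" "c \<noteq> s" "e \<notin> arc K t h"
    "U' = band s 1 \<union> bar c t h" "U = ({..<K} - {e}) \<times> {s} \<union> bar c t h"
proof -
  obtain p y where x: "(p, y) \<in> V" "U - {(p, y)} = U' - {(p, y)}" using st by (auto simp: step_def)
  obtain e where e: "e < K" "row U e = {}" using sp by (auto simp: sparse_def)
  have "row U' e \<noteq> {}" using U' e by (auto simp: strip_def mixed_def)
  have ep: "e = p"
  proof (rule ccontr)
    assume "e \<noteq> p"
    then have "row U' e = row U e" using x(2) by blast
    then show False using e \<open>row U' e \<noteq> {}\<close> by simp
  qed
  have ry: "row U' e \<subseteq> {y}" using e ep x(2) by blast
  obtain s j t h c where sc: "s < L" "1 \<le> j" "j < L" "t < K" "h < K" "1 \<le> h \<Longrightarrow> Suc j < L"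
    "c = (s + j) mod L \<or> c = (s + L - 1) mod L" "c \<notin> arc L s j" "U' = band s j \<union> bar c t h"
    using strip_is_band_with_bar[OF U'] by metis
  have "arc L s j \<subseteq> row U' e" using e sc(9) by (auto simp: band_def)
  then have "card (arc L s j) \<le> 1" using ry card_mono[of "{y}" "arc L s j"] by auto
  then have j: "j = 1" using sc by (simp add: card_arc)
  have arc: "arc L s j = {s}" using j sc(1) arc_1[of L s] by simp
  have ys: "y = s" using \<open>arc L s j \<subseteq> row U' e\<close> ry arc by auto
  have et: "e \<notin> arc K t h"
  proof
    assume "e \<in> arc K t h"
    then have "c \<in> row U' e" using sc(9) by auto
    then show False using ry ys sc(8) arc by auto
  qed
  have cs: "c \<noteq> s" using sc(8) arc by auto
  have "(e, s) \<notin> U" using e by auto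
  then have "U = U' - {(e, s)}" using x(2) ep ys by blast
  also have "\<dots> = ({..<K} - {e}) \<times> {s} \<union> bar c t h"
    using cs unfolding sc(9) band_def arc by auto
  finally show ?thesis using that[of s t h e c] sc e cs et j by simp
qed

section \<open>The families of critical sets\<close>

definition rects :: "nat \<Rightarrow> nat \<Rightarrow> vertex set set" where
  "rects a b = {rect K L i j a b | i j. i < K \<and> j < L}"

definition bars :: "nat \<Rightarrow> nat \<Rightarrow> nat \<Rightarrow> vertex set set" where
  "bars h a b = {rect K L i j a b \<union> rect K L (i + d) c 1 h | i j d c.
     i < K \<and> j < L \<and> d + h \<le> b \<and> c \<in> {j + a, j + L - 1}}"

lemma rect_eq: "rect K L i j a b = arc K i b \<times> arc L j a"
  by (auto simp: rect_def arc_def)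

lemma bars_full:
  assumes "h \<le> K"
  shows "U \<in> bars h j K \<longleftrightarrow> (\<exists>s<L. \<exists>t<K. \<exists>c. (c = (s + j) mod L \<or> c = (s + L - 1) mod L) \<and>
    U = band s j \<union> bar c t h)"
proof
  assume "U \<in> bars h j K"
  then obtain i s d c where *: "i < K" "s < L" "c \<in> {s + j, s + L - 1}"
    "U = rect K L i s j K \<union> rect K L (i + d) c 1 h" by (auto simp: bars_def)
  have "U = band s j \<union> bar (c mod L) ((i + d) mod K) h"
    using *(4) by (simp add: rect_eq band_def arc_full arc_1 arc_mod)
  moreover have "c mod L = (s + j) mod L \<or> c mod L = (s + L - 1) mod L" using *(3) by blast
  moreover have "(i + d) mod K < K" by simp
  ultimately show "\<exists>s<L. \<exists>t<K. \<exists>c. (c = (s + j) mod L \<or> c = (s + L - 1) mod L) \<and>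
    U = band s j \<union> bar c t h" using *(2) by blast
next
  assume "\<exists>s<L. \<exists>t<K. \<exists>c. (c = (s + j) mod L \<or> c = (s + L - 1) mod L) \<and> U = band s j \<union> bar c t h"
  then obtain s t c where *: "s < L" "t < K" "c \<in> {s + j, s + L - 1}" "U = band s j \<union> bar (c mod L) t h"
    by auto
  then have "U = rect K L t s j K \<union> rect K L (t + 0) c 1 h"
    by (simp add: rect_eq band_def arc_full arc_1)
  then show "U \<in> bars h j K" using *(1-3) assms unfolding bars_def
    by (intro CollectI exI[of _ t] exI[of _ s] exI[of _ 0] exI[of _ c] conjI) simp_all
qed

lemma bars_short:
  "U \<in> bars h 1 (K - 1) \<longleftrightarrow> (\<exists>e<K. \<exists>s<L. \<exists>d c. d + h \<le> K - 1 \<and> (c = Suc s mod L \<or> c = (s + L - 1) mod L) \<and>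
    U = ({..<K} - {e}) \<times> {s} \<union> bar c (Suc e + d) h)"
proof
  assume "U \<in> bars h 1 (K - 1)"
  then obtain i s d c where *: "i < K" "s < L" "c \<in> {s + 1, s + L - 1}" "d + h \<le> K - 1"
    "U = rect K L i s 1 (K - 1) \<union> rect K L (i + d) c 1 h" by (auto simp: bars_def)
  define e where "e = (i + K - 1) mod K"
  have e: "e < K" by (simp add: e_def)
  have i: "i = Suc e mod K" using *(1) pos(1) by (simp add: e_def mod_Suc_eq del: pos)
  have r: "arc K i (K - 1) = {..<K} - {e}" unfolding i arc_mod by (simp add: arc_minus_1[OF e])
  have b: "arc K (i + d) h = arc K (Suc e + d) h"
    unfolding i by (metis arc_mod mod_add_left_eq)
  have "U = ({..<K} - {e}) \<times> {s} \<union> bar (c mod L) (Suc e + d) h"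
    using *(2,5) by (simp add: rect_eq r[unfolded One_nat_def] b arc_1)
  moreover have "c mod L = Suc s mod L \<or> c mod L = (s + L - 1) mod L" using *(3) by auto
  ultimately show "\<exists>e<K. \<exists>s<L. \<exists>d c. d + h \<le> K - 1 \<and> (c = Suc s mod L \<or> c = (s + L - 1) mod L) \<and>
    U = ({..<K} - {e}) \<times> {s} \<union> bar c (Suc e + d) h"
    using *(2,4) e by blast
next
  assume "\<exists>e<K. \<exists>s<L. \<exists>d c. d + h \<le> K - 1 \<and> (c = Suc s mod L \<or> c = (s + L - 1) mod L) \<and>
    U = ({..<K} - {e}) \<times> {s} \<union> bar c (Suc e + d) h"
  then obtain e s d c' where **: "e < K" "s < L" "d + h \<le> K - 1" "c' = Suc s mod L \<or> c' = (s + L - 1) mod L"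
    "U = ({..<K} - {e}) \<times> {s} \<union> bar c' (Suc e + d) h" by blast
  then obtain c where *: "e < K" "s < L" "d + h \<le> K - 1" "c \<in> {s + 1, s + L - 1}"
    "U = ({..<K} - {e}) \<times> {s} \<union> bar (c mod L) (Suc e + d) h" by force
  have "arc K (Suc e mod K) (K - 1) = {..<K} - {e}" unfolding arc_mod by (simp add: arc_minus_1[OF *(1)])
  moreover have "arc K (Suc e mod K + d) h = arc K (Suc e + d) h" by (metis arc_mod mod_add_left_eq)
  ultimately have "U = rect K L (Suc e mod K) s 1 (K - 1) \<union> rect K L (Suc e mod K + d) c 1 h"
    using *(2,5) by (simp add: rect_eq arc_1)
  then show "U \<in> bars h 1 (K - 1)" using *(1-4) unfolding bars_def
    by (intro CollectI exI[of _ "Suc e mod K"] exI[of _ s] exI[of _ d] exI[of _ c] conjI) simp_all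
qed

lemma rects_short:
  "U \<in> rects 2 (K - 1) \<longleftrightarrow> (\<exists>e<K. \<exists>s<L. U = ({..<K} - {e}) \<times> {s, Suc s mod L})"
proof
  assume "U \<in> rects 2 (K - 1)"
  then obtain i s where *: "i < K" "s < L" "U = rect K L i s 2 (K - 1)" by (auto simp: rects_def)
  define e where "e = (i + K - 1) mod K"
  have e: "e < K" by (simp add: e_def)
  have i: "i = Suc e mod K" using *(1) pos(1) by (simp add: e_def mod_Suc_eq del: pos)
  have r: "arc K i (K - 1) = {..<K} - {e}" unfolding i arc_mod by (simp add: arc_minus_1[OF e])
  have "U = ({..<K} - {e}) \<times> {s, Suc s mod L}"
    using *(2,3) by (simp add: rect_eq r[unfolded One_nat_def] arc_Suc numeral_2_eq_2 insert_commute)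
  then show "\<exists>e<K. \<exists>s<L. U = ({..<K} - {e}) \<times> {s, Suc s mod L}" using e * by blast
next
  assume "\<exists>e<K. \<exists>s<L. U = ({..<K} - {e}) \<times> {s, Suc s mod L}"
  then obtain e s where *: "e < K" "s < L" "U = ({..<K} - {e}) \<times> {s, Suc s mod L}" by auto
  have "arc K (Suc e mod K) (K - 1) = {..<K} - {e}" unfolding arc_mod by (simp add: arc_minus_1[OF *(1)])
  then have "U = rect K L (Suc e mod K) s 2 (K - 1)"
    using * by (simp add: rect_eq arc_Suc numeral_2_eq_2 insert_commute)
  then show "U \<in> rects 2 (K - 1)" using *(1,2) unfolding rects_def
    by (intro CollectI exI[of _ "Suc e mod K"] exI[of _ s] conjI) simp_all
qed

lemma Suc_pred_mod: "s < L \<Longrightarrow> Suc ((s + L - 1) mod L) mod L = s"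
  using pos(2) by (simp add: mod_Suc_eq del: pos)

lemma rects_short':
  assumes "e < K" "s < L" "c = Suc s mod L \<or> c = (s + L - 1) mod L"
  shows "({..<K} - {e}) \<times> {s} \<union> ({..<K} - {e}) \<times> {c} \<in> rects 2 (K - 1)"
proof -
  have "({..<K} - {e}) \<times> {s} \<union> ({..<K} - {e}) \<times> {c} = ({..<K} - {e}) \<times> {s, c}" by auto
  moreover have "({..<K} - {e}) \<times> {s, c} \<in> rects 2 (K - 1)" using assms(3)
  proof
    assume "c = Suc s mod L"
    then show ?thesis unfolding rects_short using assms by blast
  next
    assume c: "c = (s + L - 1) mod L"
    have "Suc c mod L = s" unfolding c by (rule Suc_pred_mod[OF assms(2)])
    then have "{s, c} = {c, Suc c mod L}" by (simp add: insert_commute)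
    moreover have "c < L" using c by simp
    ultimately show ?thesis unfolding rects_short using assms(1) by metis
  qed
  ultimately show ?thesis by simp
qed

text \<open>Division with remainder by \<open>K\<close> recovers the width of the band and the length of the bar.\<close>

lemma strip_card_mem:
  assumes "strip U" "card U = K * j + h" "1 \<le> h" "h < K"
  shows "U \<in> bars h j K"
proof -
  obtain s j' t h' c where sc: "s < L" "1 \<le> j'" "j' < L" "t < K" "h' < K" "1 \<le> h' \<Longrightarrow> Suc j' < L"
    "c = (s + j') mod L \<or> c = (s + L - 1) mod L" "c \<notin> arc L s j'" "U = band s j' \<union> bar c t h'"
    using strip_is_band_with_bar[OF assms(1)] by metis
  have eq: "K * j' + h' = K * j + h" using card_band_bar[of j' h' c s t] sc assms(2) by simp
  have "h' = (K * j' + h') mod K" "h = (K * j + h) mod K" using sc assms by auto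
  then have "h' = h" using eq by metis
  moreover from this have "j' = j" using eq pos(1) by simp
  ultimately show ?thesis using sc assms(4) by (subst bars_full) auto
qed

section \<open>Families that separate the empty set from the torus\<close>

text \<open>The steps that a path of low sets avoiding \<open>X\<close> can make. That \<open>G\<close> is met by all low paths from the
  empty set to the torus means that they are not linked when \<open>X = G\<close>; that some low path meets \<open>G\<close> in
  \<open>U\<close> only means that they are linked when \<open>X = G - {U}\<close>.\<close>

definition link :: "vertex set set \<Rightarrow> vertex set \<Rightarrow> vertex set \<Rightarrow> bool" where
  "link X U U' \<longleftrightarrow> step U U' \<and> low U \<and> low U' \<and> U \<notin> X \<and> U' \<notin> X"

abbreviation reach :: "vertex set set \<Rightarrow> vertex set \<Rightarrow> vertex set \<Rightarrow> bool" where
  "reach X \<equiv> (link X)\<^sup>*\<^sup>*"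

lemma not_reach:
  assumes "A {}" "\<not> A V" "\<And>U U'. link X U U' \<Longrightarrow> A U \<Longrightarrow> A U'"
  shows "\<not> reach X {} V"
proof
  assume "reach X {} V"
  then have "A V" by (induction rule: rtranclp_induct) (use assms in blast)+
  then show False using assms by simp
qed

lemma sparse_empty: "sparse {}"
proof -
  have "\<not> {..<L} \<subseteq> {}" using pos(2) by blast
  then show ?thesis using pos(1) unfolding sparse_def by blast
qed

lemma row_V: "i < K \<Longrightarrow> row V i = {..<L}"
  by (auto simp: vertices_def)

lemma not_sparse_V: "\<not> sparse V"
proof -
  have "{..<L} \<noteq> {}" using pos(2) by blast
  then show ?thesis using row_V unfolding sparse_def by blast
qed

lemma not_strip_V: "\<not> strip V"
  using pos(1) row_V[of 0] unfolding strip_def mixed_def by blast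

lemma entry_card:
  assumes "s < L" "h < K" "c \<noteq> s" shows "card (band s 1 \<union> bar c t h) = K + h"
  using card_band_bar[of 1 h c s t] assms arc_1[of L s] by simp

text \<open>The sparse sets and the bands below the critical size can only be left through a band of
  exactly the critical size. The lower bound \<open>2 K - 1\<close> on that size is the largest number of cells a band can have when it
  is entered from a sparse set.\<close>

lemma bars_separate:
  assumes j: "1 \<le> j" "j \<le> L - 3" and h: "1 \<le> h" "h < K" and big: "2 * K - 1 \<le> K * j + h"
  shows "\<not> reach (bars h j K) {} V"
proof (rule not_reach[where A = "\<lambda>U. sparse U \<or> strip U \<and> card U < K * j + h"])
  fix U U' assume l: "link (bars h j K) U U'" and A: "sparse U \<or> strip U \<and> card U < K * j + h"
  note l = l[unfolded link_def]
  have hit: "card U' \<noteq> K * j + h" if "strip U'" using strip_card_mem[OF that] h l by blast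
  show "sparse U' \<or> strip U' \<and> card U' < K * j + h"
  proof (rule ccontr)
    assume n: "\<not> ?thesis"
    show False
    proof (cases "sparse U")
      case True
      have s: "strip U'" using sparse_step[of U U'] l True n by blast
      obtain s t h' c where "s < L" "h' < K" "c \<noteq> s" "U' = band s 1 \<union> bar c t h'"
        using strip_entry[OF True s] l by (metis low_def)
      then have "card U' \<le> 2 * K - 1" using entry_card[of s h' c t] by simp
      then show False using hit[OF s] n s big by simp
    next
      case False
      then have U: "strip U" "card U < K * j + h" using A by auto
      have "K * (j + 1) \<le> K * (L - 2)" using j by (intro mult_le_mono2) auto
      then have "\<not> K * (L - 2) \<le> card U" using U h by (simp add: algebra_simps)
      then have s: "strip U'" using strip_step[of U U'] l U n by blast
      have "card U' \<le> Suc (card U)"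
        using step_card[of U U'] l finite_sub by (auto simp: low_def)
      then show False using hit[OF s] n s U by simp
    qed
  qed
qed (simp_all add: sparse_empty not_sparse_V not_strip_V)

text \<open>A band can be entered at size \<open>2 K - 1\<close>, above the critical size \<open>2 K - 2\<close>, but then the step
  starts in the rectangle of two columns and \<open>K - 1\<close> rows.\<close>

lemma Q_family_separates: "\<not> reach (rects 2 (K - 1) \<union> bars (K - 2) 1 K) {} V"
proof (rule not_reach[where A = "\<lambda>U. sparse U \<or> strip U \<and> card U < 2 * K - 2"])
  let ?X = "rects 2 (K - 1) \<union> bars (K - 2) 1 K"
  fix U U' assume l: "link ?X U U'" and A: "sparse U \<or> strip U \<and> card U < 2 * K - 2"
  note l = l[unfolded link_def]
  have hit: "card U' \<noteq> 2 * K - 2" if "strip U'"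
  proof
    assume "card U' = 2 * K - 2"
    then have "card U' = K * 1 + (K - 2)" using K_ge_3 by simp
    then have "U' \<in> bars (K - 2) 1 K" using K_ge_3 by (intro strip_card_mem that) auto
    then show False using l by simp
  qed
  show "sparse U' \<or> strip U' \<and> card U' < 2 * K - 2"
  proof (rule ccontr)
    assume n: "\<not> ?thesis"
    show False
    proof (cases "sparse U")
      case True
      have s: "strip U'" using sparse_step[of U U'] l True n by blast
      have sub: "U \<subseteq> V" using l by (simp add: low_def)
      obtain s t h' c e where e: "s < L" "t < K" "h' < K" "e < K"
        "c = Suc s mod L \<or> c = (s + L - 1) mod L" "c \<noteq> s" "e \<notin> arc K t h'"
        "U' = band s 1 \<union> bar c t h'" "U = ({..<K} - {e}) \<times> {s} \<union> bar c t h'"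
        using strip_entry[OF True s _ sub] l by metis
      then have "card U' = K + h'" using entry_card[of s h' c t] by simp
      then have h': "h' = K - 1" using hit[OF s] n s e(3) by auto
      have "arc K t h' = {..<K} - {e}"
        by (rule card_subset_eq) (use arc_subset[of K t h'] e h' in \<open>auto simp: card_arc\<close>)
      then have "U \<in> rects 2 (K - 1)" using rects_short'[of e s c] e by auto
      then show False using l by simp
    next
      case False
      then have U: "strip U" "card U < 2 * K - 2" using A by auto
      have "K * 2 \<le> K * (L - 2)" using K_ge_3 K_less_L by (intro mult_le_mono2) auto
      then have "\<not> K * (L - 2) \<le> card U" using U by linarith
      then have s: "strip U'" using strip_step[of U U'] l U n by blast
      have "card U' \<le> Suc (card U)"
        using step_card[of U U'] l finite_sub by (auto simp: low_def)
      then show False using hit[OF s] n s U by simp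
    qed
  qed
qed (simp_all add: sparse_empty not_sparse_V not_strip_V)

text \<open>The \<open>K - 1\<close> nonempty rows are cut and use up \<open>2 K - 2\<close>. This leaves \<open>4\<close>, hence two columns. When
  a single cell is missing from these columns outside the empty row, both columns are cut and the whole perimeter
  is used up: each cut row and column has exactly two turns. So the columns are adjacent, and the missing cell lies at an
  end of its column.\<close>

lemma wide_sparse_two_columns:
  assumes low: "low U" and sp: "sparse U" and e: "e < K" "row U e = {}"
    and ne: "\<And>i. i < K \<Longrightarrow> i \<noteq> e \<Longrightarrow> row U i \<noteq> {}"
    and big: "2 * K - 3 \<le> card U" and K4: "4 \<le> K"
  obtains c1 c2 where "c1 \<noteq> c2" "U \<subseteq> ({..<K} - {e}) \<times> {c1, c2}"
    "card U = 2 * K - 3 \<Longrightarrow> U \<in> bars (K - 2) 1 (K - 1)"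
proof -
  let ?I = "{..<K} - {e}"
  have sub: "U \<subseteq> V" and perimeter: "perimeter U \<le> 2 * K + 2" using low by (auto simp: low_def)
  have mix: "mixed L (row U i)" if i: "i < K" "i \<noteq> e" for i
  proof (rule ccontr)
    assume "\<not> ?thesis"
    then have f: "{..<L} \<subseteq> row U i" using mixed_row[OF sub] ne[OF i] by auto
    define g :: nat where "g = (if 0 \<noteq> e \<and> 0 \<noteq> i then 0 else if 1 \<noteq> e \<and> 1 \<noteq> i then 1 else 2)"
    have g: "g < K" "g \<noteq> e" "g \<noteq> i" using K_ge_3 by (auto simp: g_def)
    then have "{..<L} \<subseteq> row U g"
      using no_mixed_row[OF low e i(1) f g(1)] mixed_row[OF sub] ne[OF g(1,2)] by auto
    then show False using sp f g i unfolding sparse_def by blast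
  qed
  have cI: "card ?I = K - 1" using e by simp
  have rows: "2 * (K - 1) \<le> (\<Sum>i<K. turns L (row U i))"
    using rows_ge[of ?I U] mix cI by simp
  have cols: "(\<Sum>j<L. turns K (col U j)) \<le> 4" using rows perimeter K_ge_3 by (simp add: perimeter_def)
  define Y where "Y = {y. y < L \<and> col U y \<noteq> {}}"
  have Yf: "finite Y" by (simp add: Y_def)
  have mixc: "mixed K (col U y)" if y: "y \<in> Y" for y
  proof -
    obtain i where i: "(i, y) \<in> U" using y unfolding Y_def by blast
    then have "i < K" using sub by (auto simp: vertices_def)
    moreover have "(e, y) \<notin> U" using e by blast
    ultimately show ?thesis using i e(1) unfolding mixed_def by blast
  qed
  have Y2: "card Y \<le> 2" using cols_ge[of Y U] mixc cols by (force simp: Y_def)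
  have UY: "U \<subseteq> ?I \<times> Y"
  proof
    fix v assume v: "v \<in> U"
    obtain a b where ab: "v = (a, b)" by (cases v)
    have "a < K" "b < L" "a \<noteq> e" using v ab sub e by (auto simp: vertices_def)
    then show "v \<in> ?I \<times> Y" using v ab by (auto simp: Y_def)
  qed
  have "card U \<le> card (?I \<times> Y)" by (rule card_mono) (use UY Yf in auto)
  then have cU: "card U \<le> (K - 1) * card Y" using cI by (simp add: card_cartesian_product)
  have "\<not> card Y \<le> 1"
  proof
    assume "card Y \<le> 1"
    then have "(K - 1) * card Y \<le> K - 1" using mult_le_mono2[of "card Y" 1 "K - 1"] by simp
    then show False using cU big K4 by linarith
  qed
  then have "card Y = 2" using Y2 by simp
  then obtain c1 c2 where c: "Y = {c1, c2}" "c1 \<noteq> c2" by (auto simp: card_2_iff)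
  have "U \<in> bars (K - 2) 1 (K - 1)" if card: "card U = 2 * K - 3"
  proof -
    have "card (?I \<times> Y) = 2 * K - 2" using cI \<open>card Y = 2\<close> by (simp add: card_cartesian_product)
    moreover have "card (?I \<times> Y - U) = card (?I \<times> Y) - card U"
      by (rule card_Diff_subset) (use UY finite_sub[OF sub] in auto)
    ultimately have "card (?I \<times> Y - U) = 1" using card K4 by simp
    then obtain z w where zw: "?I \<times> Y - U = {(z, w)}" by (metis card_1_singletonE surj_pair)
    obtain w' where w': "Y = {w, w'}" "w \<noteq> w'"
      using c zw by (metis Diff_iff SigmaD2 doubleton_eq_iff insertE insertI1 singletonD)
    have z: "z < K" "z \<noteq> e" using zw by blast+
    have wL: "w < L" "w' < L" using w' unfolding Y_def by auto
    have "U = ?I \<times> Y - (?I \<times> Y - U)" using UY by blast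
    then have "U = ?I \<times> Y - {(z, w)}" unfolding zw .
    then have Ueq: "U = ?I \<times> {w, w'} - {(z, w)}" unfolding w'(1) .
    have mem: "(a, b) \<in> U \<longleftrightarrow> a < K \<and> a \<noteq> e \<and> (b = w' \<or> b = w \<and> a \<noteq> z)" for a b
      unfolding Ueq using w'(2) by auto
    have "(\<Sum>j\<in>{w, w'}. turns K (col U j)) \<le> (\<Sum>j<L. turns K (col U j))"
      by (rule sum_mono2) (use wL in auto)
    then have s4: "turns K (col U w) + turns K (col U w') \<le> 4" using w' cols by simp
    have ge: "2 \<le> turns K (col U w)" "2 \<le> turns K (col U w')"
      using mixc w' turns_mixed_ge_2 by auto
    then have "turns K (col U w) \<le> 2" using s4 by simp
    then obtain t h where th: "t < K" "1 \<le> h" "h < K" "col U w = arc K t h"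
      using arc_if_turns_le_2[OF mixc[of w] col_subset[OF sub]] w' by blast
    have colw: "col U w = {..<K} - {e, z}" using mem w' by auto
    have "h = card ({..<K} - {e, z})"
      unfolding colw[symmetric] th(4) using th(3) by (simp add: card_arc)
    also have "\<dots> = K - 2" using z e by (subst card_Diff_subset) auto
    finally have h: "h = K - 2" .
    have "e \<notin> arc K t h" unfolding th(4)[symmetric] colw by simp
    then obtain d where d: "d + h \<le> K - 1" "arc K t h = arc K (Suc e + d) h"
      using arc_avoiding[of e K t h] th e by auto
    define i where "i = (if 0 \<noteq> e \<and> 0 \<noteq> z then 0 else if 1 \<noteq> e \<and> 1 \<noteq> z then 1 else 2::nat)"
    have i: "i < K" "i \<noteq> e" "i \<noteq> z" using K_ge_3 by (auto simp: i_def)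
    have row: "row U i = insert w (arc L w' 1)" using mem i wL by (auto simp: arc_1)
    have "turns L (row U i) \<le> 2"
    proof -
      have "4 \<le> (\<Sum>j<L. turns K (col U j))"
        using \<open>(\<Sum>j\<in>{w, w'}. turns K (col U j)) \<le> (\<Sum>j<L. turns K (col U j))\<close> ge w' by simp
      then have "(\<Sum>i<K. turns L (row U i)) \<le> 2 * K - 2" using perimeter by (simp add: perimeter_def)
      moreover have "(\<Sum>i<K. turns L (row U i)) = turns L (row U i) + (\<Sum>i\<in>{..<K} - {i}. turns L (row U i))"
        using i by (intro sum.remove) auto
      moreover have "(\<Sum>a\<in>?I - {i}. 2) \<le> (\<Sum>a\<in>?I - {i}. turns L (row U a))"
        by (rule sum_mono) (use mix turns_mixed_ge_2 in auto)
      moreover have "(\<Sum>a\<in>?I - {i}. turns L (row U a)) \<le> (\<Sum>i\<in>{..<K} - {i}. turns L (row U i))"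
        by (rule sum_mono2) auto
      moreover have "card (?I - {i}) = K - 2" using i cI by (subst card_Diff_singleton) auto
      ultimately show ?thesis using K4 by simp
    qed
    moreover have "w \<notin> arc L w' 1" using w' wL by (simp add: arc_1)
    ultimately have "w = (w' + 1) mod L \<or> w = (w' + L - 1) mod L"
      using arc_extend[of w' L 1 w] wL mix[OF i(1,2)] K_ge_3 K_less_L unfolding row by simp
    moreover have "U = ?I \<times> {w'} \<union> bar w (Suc e + d) h"
    proof -
      have "bar w (Suc e + d) h = ({..<K} - {e, z}) \<times> {w}" using d th colw by simp
      then show ?thesis using mem by auto
    qed
    ultimately show ?thesis unfolding bars_short using e wL d h by (metis Suc_eq_plus1)
  qed
  then show ?thesis using that[of c1 c2] c UY by simp
qed

text \<open>Here the set from which the bands are entered matters: for a bar of length between \<open>i + 1\<close> and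
  \<open>K - 2\<close> it is in the gate, and for the longest bar it is the rectangle of two columns, which is
  kept outside the invariant by excluding the sets with one empty row and at least \<open>2 K - 3\<close> cells.\<close>

lemma H_family_separates:
  assumes i: "1 \<le> i" "i \<le> K - 3"
  shows "\<not> reach (bars i 1 K \<union> (\<Union>h\<in>{i + 1..K - 2}. bars h 1 (K - 1))) {} V" (is "\<not> reach ?X _ _")
proof -
  \<comment> \<open>The sets with one empty row that are too full to be on the near side of the gate.\<close>
  define fat where "fat U \<longleftrightarrow> (\<exists>e<K. row U e = {} \<and> (\<forall>i<K. i \<noteq> e \<longrightarrow> row U i \<noteq> {})) \<and> 2 * K - 3 \<le> card U"
    for U :: "vertex set"
  have K4: "4 \<le> K" using i by simp
  show ?thesis
  proof (rule not_reach[where A = "\<lambda>U. sparse U \<and> \<not> fat U \<or> strip U \<and> card U < K + i"])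
    fix U U' assume l: "link ?X U U'" and A: "sparse U \<and> \<not> fat U \<or> strip U \<and> card U < K + i"
    note l = l[unfolded link_def]
    have sub: "U \<subseteq> V" "U' \<subseteq> V" using l by (auto simp: low_def)
    have cc: "card U' \<le> Suc (card U)" "card U \<le> Suc (card U')"
      using step_card[of U U'] step_card[of U' U] step_sym l finite_sub sub by auto
    have hit: "card U' \<noteq> K + i" if "strip U'"
    proof
      assume "card U' = K + i"
      then have "U' \<in> bars i 1 K" using i by (intro strip_card_mem that) auto
      then show False using l by simp
    qed
    show "sparse U' \<and> \<not> fat U' \<or> strip U' \<and> card U' < K + i"
    proof (rule ccontr)
      assume n: "\<not> ?thesis"
      show False
      proof (cases "sparse U'")
        case True
        then have f: "fat U'" using n by simp
        then obtain e where e: "e < K" "row U' e = {}" "\<And>i. i < K \<Longrightarrow> i \<noteq> e \<Longrightarrow> row U' i \<noteq> {}"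
          "2 * K - 3 \<le> card U'" by (auto simp: fat_def)
        obtain c1 c2 where c: "c1 \<noteq> c2" "U' \<subseteq> ({..<K} - {e}) \<times> {c1, c2}"
            "card U' = 2 * K - 3 \<Longrightarrow> U' \<in> bars (K - 2) 1 (K - 1)"
          using wide_sparse_two_columns[of U' e] l True e K4 by blast
        have "card U' \<noteq> 2 * K - 3" using c(3) l i by fastforce
        then have c22: "2 * K - 2 \<le> card U'" using e(4) by simp
        have cD: "card (({..<K} - {e}) \<times> {c1, c2}) = 2 * K - 2"
          using e c(1) by (simp add: card_cartesian_product)
        have U'eq: "U' = ({..<K} - {e}) \<times> {c1, c2}"
          by (rule card_seteq) (use c c22 cD in auto)
        have cU: "2 * K - 3 \<le> card U" using c22 cc by simp
        \<comment> \<open>Both cells of the rows of \<open>U'\<close> cannot have been added at once, so \<open>U\<close> was \<open>fat\<close> already.\<close>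
        have rows: "row U i \<noteq> {}" if "i < K" "i \<noteq> e" for i
        proof -
          obtain x where x: "U - {x} = U' - {x}" using l by (auto simp: step_def)
          have "(i, c1) \<in> U'" "(i, c2) \<in> U'" using U'eq that by auto
          then have "(i, c1) \<in> U \<or> (i, c2) \<in> U" using x c(1) by blast
          then show ?thesis by blast
        qed
        have "\<not> card U < K + i" using cU i K4 by simp
        then have U: "sparse U" "\<not> fat U" using A by auto
        then obtain e' where "e' < K" "row U e' = {}" by (auto simp: sparse_def)
        then have "row U e = {}" using rows by metis
        then have "fat U" unfolding fat_def using e(1) rows cU by blast
        then show False using U by simp
      next
        case F: False
        show False
        proof (cases "sparse U \<and> \<not> fat U")
          case True
          then have spU: "sparse U" by simp
          have s: "strip U'" using sparse_step[of U U'] l True F by blast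
          obtain s t h' c e where e: "s < L" "t < K" "h' < K" "e < K"
            "c = Suc s mod L \<or> c = (s + L - 1) mod L" "c \<noteq> s" "e \<notin> arc K t h'"
            "U' = band s 1 \<union> bar c t h'" "U = ({..<K} - {e}) \<times> {s} \<union> bar c t h'"
            using strip_entry[OF spU s _ sub(1)] l by metis
          have cU': "card U' = K + h'" using entry_card[of s h' c t] e by simp
          then have h': "i < h'" using hit[OF s] n s e(3) by auto
          have at: "arc K t h' \<subseteq> {..<K} - {e}" using arc_subset[of K t h'] e by auto
          show False
          proof (cases "h' \<le> K - 2")
            case True
            obtain d where d: "d + h' \<le> K - 1" "arc K t h' = arc K (Suc e + d) h'"
              using arc_avoiding[of e K t h'] e h' by auto
            have "U \<in> bars h' 1 (K - 1)" unfolding bars_short using e d by blast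
            then show False using l h' True by fastforce
          next
            case False
            then have h': "h' = K - 1" using e by simp
            have ae: "arc K t h' = {..<K} - {e}"
              by (rule card_subset_eq) (use at h' e in \<open>auto simp: card_arc\<close>)
            have "2 * K - 3 \<le> card U" using cU' cc(1) h' by simp
            moreover have "row U e = {}" using e(9) ae by auto
            moreover have "\<forall>i<K. i \<noteq> e \<longrightarrow> row U i \<noteq> {}" using e(9) by auto
            ultimately have "fat U" using e(4) unfolding fat_def by blast
            then show False using True by simp
          qed
        next
          case False
          then have U: "strip U" "card U < K + i" using A by auto
          have "K * 2 \<le> K * (L - 2)" using K_ge_3 K_less_L by (intro mult_le_mono2) auto
          then have "\<not> K * (L - 2) \<le> card U" using U i by linarith
          then have s: "strip U'" using strip_step[of U U'] l U F by blast
          then show False using hit[OF s] n U cc by simp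
        qed
      qed
    qed
  next
    show "sparse {} \<and> \<not> fat {} \<or> strip {} \<and> card {} < K + i"
      using sparse_empty K4 by (simp add: fat_def)
  qed (simp_all add: not_sparse_V not_strip_V)
qed

section \<open>Paths that add cells\<close>

definition climb :: "vertex set \<Rightarrow> vertex set \<Rightarrow> bool" where
  "climb = (\<lambda>U U'. (\<exists>x. U' = insert x U) \<and> low U \<and> low U')\<^sup>*\<^sup>*"

lemma climb_refl: "climb U U" by (simp add: climb_def)

lemma climb_trans: "climb U U' \<Longrightarrow> climb U' U'' \<Longrightarrow> climb U U''"
  unfolding climb_def by (rule rtranclp_trans)

lemma climb_insert: "low U \<Longrightarrow> low (insert x U) \<Longrightarrow> climb U (insert x U)"
  unfolding climb_def by (rule r_into_rtranclp) blast

lemma climb_subset: "climb U U' \<Longrightarrow> U \<subseteq> U'"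
  unfolding climb_def by (induction rule: rtranclp_induct) auto

lemma reach_climb:
  assumes "climb S T" "\<And>Z. S \<subseteq> Z \<Longrightarrow> Z \<subseteq> T \<Longrightarrow> Z \<notin> X"
  shows "reach X S T"
  using assms unfolding climb_def
proof (induction rule: rtranclp_induct)
  case (step T1 T2)
  obtain x where x: "T2 = insert x T1" "low T1" "low T2" using step by auto
  have S: "S \<subseteq> T1" using climb_subset step(1) by (simp add: climb_def)
  have "reach X S T1" by (rule step.IH) (use step.prems x in blast)
  moreover have "link X T1 T2" unfolding link_def
  proof (intro conjI)
    show "step T1 T2" using x by (auto simp: step_def low_def)
    show "T1 \<notin> X" "T2 \<notin> X" using step.prems[of T1] step.prems[of T2] S x(1) by blast+
  qed (use x in auto)
  ultimately show ?case by simp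
qed simp

lemma climb_fill:
  assumes "a \<le> b" "\<And>m. a \<le> m \<Longrightarrow> m \<le> b \<Longrightarrow> low (S \<union> bar c t m)"
  shows "climb (S \<union> bar c t a) (S \<union> bar c t b)"
  using assms
proof (induction b rule: dec_induct)
  case base then show ?case by (simp add: climb_refl)
next
  case (step b)
  have eq: "S \<union> bar c t (Suc b) = insert ((t + b) mod K, c) (S \<union> bar c t b)"
    by (auto simp: arc_Suc)
  have "climb (S \<union> bar c t b) (S \<union> bar c t (Suc b))" unfolding eq
  proof (rule climb_insert)
    show "low (S \<union> bar c t b)" using step by simp
    show "low (insert ((t + b) mod K, c) (S \<union> bar c t b))" unfolding eq[symmetric] using step by simp
  qed
  moreover have "climb (S \<union> bar c t a) (S \<union> bar c t b)" using step by simp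
  ultimately show ?case using climb_trans by blast
qed

lemma low_if_perimeter: "ortho U \<Longrightarrow> perimeter U \<le> 2 * K + 2 \<Longrightarrow> low U" by (simp add: low_def ortho_def)

text \<open>The two columns next to a band of \<open>j\<close> columns starting from column \<open>s\<close>.\<close>

abbreviation flank :: "nat \<Rightarrow> nat \<Rightarrow> nat \<Rightarrow> bool" where
  "flank s j c \<equiv> c = (s + j) mod L \<or> c = (s + L - 1) mod L"

lemma flank_not_mem:
  assumes "flank s j c" "j < L" shows "c \<notin> arc L s j"
  using assms(1)
proof
  assume "c = (s + j) mod L" then show ?thesis using mem_arc_iff[of j L j s] assms by simp
next
  assume "c = (s + L - 1) mod L"
  then have "c = (s + (L - 1)) mod L" using pos(2) by (simp add: Nat.add_diff_assoc Suc_le_eq del: pos)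
  then show ?thesis using mem_arc_iff[of "L - 1" L j s] assms by simp
qed

lemma flank_arc:
  assumes "flank s j c" "s < L"
  obtains s' where "s' < L" "insert c (arc L s j) = arc L s' (Suc j)"
  using assms(1)
proof
  assume "c = (s + j) mod L" then show ?thesis using that[of s] assms by (simp add: arc_Suc)
next
  assume "c = (s + L - 1) mod L"
  then show ?thesis using that[of "(s + L - 1) mod L"] insert_left_arc[OF pos(2), of s j] by (simp add: arc_mod)
qed

lemma row_band_bar:
  "i < K \<Longrightarrow> row (band s j \<union> bar c t h) i = (if i \<in> arc K t h then insert c (arc L s j) else arc L s j)"
  by (auto simp: band_def)

lemma col_band_bar:
  "col (band s j \<union> bar c t h) y =
    (if y \<in> arc L s j then {..<K} else if y = c then arc K t h else {})"
  using arc_subset[of K t h] by (auto simp: band_def)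

lemma not_mixed_full [simp]: "\<not> mixed N {..<N}" by (auto simp: mixed_def)
lemma not_mixed_empty [simp]: "\<not> mixed N {}" by (auto simp: mixed_def)

lemma ortho_band_bar:
  assumes f: "flank s j c" and s: "s < L" and j: "j < L" and h: "h \<le> K"
  shows "ortho (band s j \<union> bar c t h)"
  unfolding ortho_def
proof (intro conjI allI impI)
  have "c < L" using f by auto
  then show "band s j \<union> bar c t h \<subseteq> V" by (rule band_bar_sub)
  show "turns K (col (band s j \<union> bar c t h) y) \<le> 2" for y
    unfolding col_band_bar using turns_arc_le_2[OF h, of t] by (simp add: turns_not_mixed)
  obtain s' where "insert c (arc L s j) = arc L s' (Suc j)" using flank_arc[OF f s] by metis
  then show "turns L (row (band s j \<union> bar c t h) i) \<le> 2" if "i < K" for i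
    unfolding row_band_bar[OF that] using j turns_arc_le_2[of "Suc j" L s'] turns_arc_le_2[of j L s] by simp
qed

text \<open>At most \<open>K\<close> rows and the one column of the bar are cut.\<close>

lemma low_band_bar:
  assumes "flank s j c" "s < L" "j < L" "h \<le> K"
  shows "low (band s j \<union> bar c t h)"
proof (rule low_if_perimeter)
  show "ortho (band s j \<union> bar c t h)" by (rule ortho_band_bar) fact+
  then have "perimeter (band s j \<union> bar c t h) \<le> 2 * (card {..<K} + card {c})"
  proof (rule perimeter_le)
    show "\<not> mixed K (col (band s j \<union> bar c t h) y)" if "y < L" "y \<notin> {c}" for y
      unfolding col_band_bar using that by simp
  qed auto
  then show "perimeter (band s j \<union> bar c t h) \<le> 2 * K + 2" by simp
qed

lemma band_grow:
  assumes "flank s j c" "s < L" "j < L" "h \<le> K"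
  obtains s' where "s' < L" "climb (band s j \<union> bar c t h) (band s' (Suc j))"
    "band s' (Suc j) = {..<K} \<times> insert c (arc L s j)"
proof -
  obtain s' where s': "s' < L" "insert c (arc L s j) = arc L s' (Suc j)" using flank_arc[OF assms(1,2)] by metis
  have "band s j \<union> bar c t K = band s' (Suc j)"
    using s'(2)[symmetric] by (auto simp: band_def arc_full)
  moreover have "climb (band s j \<union> bar c t h) (band s j \<union> bar c t K)"
    using assms by (intro climb_fill low_band_bar) auto
  ultimately show ?thesis using that s' by (simp add: band_def)
qed

lemma climb_band_V: "s < L \<Longrightarrow> j \<le> L \<Longrightarrow> climb (band s j) V"
proof (induction "L - j" arbitrary: s j)
  case 0
  then have j: "j = L" by simp
  have "band s j = V" unfolding j band_def arc_full[OF pos(2)] by (auto simp: vertices_def)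
  then show ?case by (simp add: climb_refl)
next
  case (Suc n)
  have "j < L" using Suc(2) by simp
  then obtain s' where "s' < L" "climb (band s j \<union> bar ((s + j) mod L) 0 0) (band s' (Suc j))"
    using band_grow[where s = s and j = j and c = "(s + j) mod L" and h = 0 and t = 0] Suc(3)
    by (metis le0)
  moreover from this have "climb (band s' (Suc j)) V" using Suc(1)[of "Suc j" s'] Suc(2-4) by simp
  ultimately show ?case using climb_trans by simp
qed

lemma climb_empty_band: "s < L \<Longrightarrow> j \<le> L \<Longrightarrow> climb {} (band s j)"
proof (induction j)
  case 0 then show ?case by (simp add: band_def climb_refl)
next
  case (Suc j)
  have "climb (band s j \<union> bar ((s + j) mod L) 0 0) (band s j \<union> bar ((s + j) mod L) 0 K)"
    using Suc by (intro climb_fill low_band_bar) auto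
  moreover have "band s j \<union> bar ((s + j) mod L) 0 K = band s (Suc j)"
    by (auto simp: band_def arc_full arc_Suc)
  ultimately show ?case using Suc climb_trans by simp
qed

lemma climb_band_bar_V:
  assumes "flank s j c" "s < L" "j < L" "h \<le> K" shows "climb (band s j \<union> bar c t h) V"
proof -
  obtain s' where "s' < L" "climb (band s j \<union> bar c t h) (band s' (Suc j))" using band_grow[OF assms] by metis
  then show ?thesis using climb_band_V[of s' "Suc j"] assms climb_trans by force
qed

lemma climb_empty_band_bar:
  assumes "flank s j c" "s < L" "j < L" "h \<le> K" shows "climb {} (band s j \<union> bar c t h)"
proof -
  have "climb (band s j \<union> bar c t 0) (band s j \<union> bar c t h)"
    using assms by (intro climb_fill low_band_bar) auto
  then show ?thesis using climb_empty_band[of s j] assms climb_trans by force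
qed

lemma flank_1: "s < L \<Longrightarrow> flank s 1 c \<Longrightarrow> c < L \<and> c \<noteq> s"
  using flank_not_mem[where s = s and j = 1 and c = c] K_ge_3 K_less_L by (auto simp: arc_1)

lemma ortho_pair:
  assumes s: "s < L" and c: "flank s 1 c" and A: "A \<subseteq> {..<K}" "turns K A \<le> 2" and B: "B \<subseteq> {..<K}" "turns K B \<le> 2"
  shows "ortho (A \<times> {s} \<union> B \<times> {c})"
  unfolding ortho_def
proof (intro conjI allI impI)
  have cL: "c < L" "c \<noteq> s" using flank_1[OF s c] by blast+
  show "A \<times> {s} \<union> B \<times> {c} \<subseteq> V" using cL(1) s A(1) B(1) by (auto simp: vertices_def)
  show "turns K (col (A \<times> {s} \<union> B \<times> {c}) j) \<le> 2" for j
  proof -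
    have "col (A \<times> {s} \<union> B \<times> {c}) j = (if j = s then A else if j = c then B else {})"
      using cL by auto
    then show ?thesis using A B by (simp add: turns_not_mixed)
  qed
  obtain s' where s': "insert c (arc L s 1) = arc L s' (Suc 1)" using flank_arc[OF c s] by metis
  show "turns L (row (A \<times> {s} \<union> B \<times> {c}) i) \<le> 2" for i
  proof -
    have *: "turns L (arc L x m) \<le> 2" if "m \<le> 2" for x m
      using that K_ge_3 K_less_L by (intro turns_arc_le_2) simp
    have "row (A \<times> {s} \<union> B \<times> {c}) i =
      (if i \<in> A then if i \<in> B then insert c (arc L s 1) else arc L s 1 else if i \<in> B then arc L c 1 else arc L s 0)"
      using cL s by (auto simp: arc_1)
    then show ?thesis using *[of "Suc 1" s'] *[of 1 s] *[of 1 c] *[of 0 s] unfolding s' by simp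
  qed
qed

text \<open>With one row empty there remain at most \<open>K - 1\<close> cut rows, so two cut columns can be afforded.\<close>

lemma low_pair:
  assumes "s < L" "flank s 1 c" "e < K" "A \<subseteq> {..<K} - {e}" "turns K A \<le> 2" "B \<subseteq> {..<K} - {e}" "turns K B \<le> 2"
  shows "low (A \<times> {s} \<union> B \<times> {c})"
proof (rule low_if_perimeter)
  show o: "ortho (A \<times> {s} \<union> B \<times> {c})" using assms by (intro ortho_pair) auto
  have "perimeter (A \<times> {s} \<union> B \<times> {c}) \<le> 2 * (card ({..<K} - {e}) + card {s, c})"
  proof (rule perimeter_le[OF o])
    fix i assume "i < K" "i \<notin> {..<K} - {e}"
    then have r: "row (A \<times> {s} \<union> B \<times> {c}) i = {}" using assms by auto
    show "\<not> mixed L (row (A \<times> {s} \<union> B \<times> {c}) i)" unfolding r by simp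
  next
    fix j assume "j < L" "j \<notin> {s, c}"
    then have r: "col (A \<times> {s} \<union> B \<times> {c}) j = {}" by auto
    show "\<not> mixed K (col (A \<times> {s} \<union> B \<times> {c}) j)" unfolding r by simp
  qed auto
  moreover have "card {s, c} \<le> 2" by (simp add: card_insert_if)
  ultimately show "perimeter (A \<times> {s} \<union> B \<times> {c}) \<le> 2 * K + 2" using assms(3) K_ge_3 by auto
qed

lemma arc_mono: "m \<le> m' \<Longrightarrow> arc N s m \<subseteq> arc N s m'" by (auto simp: arc_def)

lemma climb_empty_pair:
  assumes s: "s < L" "flank s 1 c" and e: "e < K"
    and A: "arc K a m \<subseteq> {..<K} - {e}" "m \<le> K" and B: "arc K b h \<subseteq> {..<K} - {e}" "h \<le> K"
  shows "climb {} (arc K a m \<times> {s} \<union> arc K b h \<times> {c})"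
proof -
  have "climb ({} \<union> bar s a 0) ({} \<union> bar s a m)"
  proof (rule climb_fill)
    fix l assume "l \<le> m"
    then have "low (arc K a l \<times> {s} \<union> {} \<times> {c})"
      using s e A arc_mono[of l m K a] by (intro low_pair) (auto intro: turns_arc_le_2 simp: turns_not_mixed)
    then show "low ({} \<union> bar s a l)" by simp
  qed simp
  moreover have "climb (bar s a m \<union> bar c b 0) (bar s a m \<union> bar c b h)"
  proof (rule climb_fill)
    fix l assume "l \<le> h"
    then show "low (bar s a m \<union> bar c b l)"
      using s e A B arc_mono[of l h K b] by (intro low_pair) (auto intro: turns_arc_le_2)
  qed simp
  ultimately show ?thesis using climb_trans by simp
qed

section \<open>Minimal gates of vertex sets\<close>

text \<open>Connectedness of \<open>U\<close> in the form in which it is applied to configurations.\<close>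

definition conn :: "vertex set \<Rightarrow> bool" where
  "conn U \<longleftrightarrow> (\<forall>\<tau> :: config.
     (\<forall>i<K. \<forall>j<L. (i, j) \<in> U \<longrightarrow> (i, Suc j mod L) \<in> U \<longrightarrow> \<tau> (i, j) = \<tau> (i, Suc j mod L)) \<longrightarrow>
     (\<forall>i<K. \<forall>j<L. (i, j) \<in> U \<longrightarrow> (Suc i mod K, j) \<in> U \<longrightarrow> \<tau> (i, j) = \<tau> (Suc i mod K, j)) \<longrightarrow>
     (\<forall>v\<in>U. \<forall>w\<in>U. \<tau> v = \<tau> w))"

text \<open>Every row is an interval that meets the column \<open>c\<close>, whose part in \<open>U\<close> is an interval as well.\<close>

lemma conn_spine:
  assumes o: "ortho U" and c: "c < L" and spine: "\<And>i. i < K \<Longrightarrow> row U i \<noteq> {} \<Longrightarrow> (i, c) \<in> U"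
  shows "conn U"
  unfolding conn_def
proof (intro allI impI ballI)
  fix \<tau> :: config and v w
  assume h: "\<forall>i<K. \<forall>j<L. (i, j) \<in> U \<longrightarrow> (i, Suc j mod L) \<in> U \<longrightarrow> \<tau> (i, j) = \<tau> (i, Suc j mod L)"
    and k: "\<forall>i<K. \<forall>j<L. (i, j) \<in> U \<longrightarrow> (Suc i mod K, j) \<in> U \<longrightarrow> \<tau> (i, j) = \<tau> (Suc i mod K, j)"
    and vw: "v \<in> U" "w \<in> U"
  have U: "U \<subseteq> V" using o by (simp add: ortho_def)
  have row: "\<tau> (i, j) = \<tau> (i, c)" "(i, c) \<in> U" if "(i, j) \<in> U" for i j
  proof -
    have ij: "i < K" "j < L" using that U by (auto simp: vertices_def)
    show ic: "(i, c) \<in> U" using spine[of i] ij that by blast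
    show "\<tau> (i, j) = \<tau> (i, c)"
      by (rule const_if_turns_le_2[OF pos(2) row_subset[OF U, of i], where f = "\<lambda>j. \<tau> (i, j)"])
        (use o ij h ic that row_subset[OF U, of i] in \<open>auto simp: ortho_def\<close>)
  qed
  have col: "\<tau> (i, c) = \<tau> (i', c)" if "(i, c) \<in> U" "(i', c) \<in> U" for i i'
    by (rule const_if_turns_le_2[OF pos(1) col_subset[OF U, of c], where f = "\<lambda>i. \<tau> (i, c)"])
      (use o c k that col_subset[OF U, of c] in \<open>auto simp: ortho_def\<close>)
  obtain a b a' b' where "v = (a, b)" "w = (a', b')" by (cases v, cases w)
  then show "\<tau> v = \<tau> w" using row[of a b] row[of a' b'] col[of a a'] vw by simp
qed

lemma ortho_compl:
  assumes "ortho U" shows "ortho (V - U)"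
  unfolding ortho_def
proof (intro conjI allI impI)
  fix i assume i: "i < K"
  have "row (V - U) i = {..<L} - row U i" using i by (auto simp: mem_V)
  then show "turns L (row (V - U) i) \<le> 2" using assms i by (simp only: turns_compl) (simp add: ortho_def)
next
  fix j assume j: "j < L"
  have "col (V - U) j = {..<K} - col U j" using j by (auto simp: mem_V)
  then show "turns K (col (V - U) j) \<le> 2" using assms j by (simp only: turns_compl) (simp add: ortho_def)
qed auto

text \<open>As \<open>U\<close> and its complement are both connected, whichever of them carries the spins other than \<open>r\<close>
  carries just one such spin, as long as the energy is low.\<close>

definition good :: "vertex set \<Rightarrow> bool" where
  "good U \<longleftrightarrow> U \<subseteq> V \<and> perimeter U = 2 * K + 2 \<and> conn U \<and> conn (V - U)"

lemma good_compl: "good U \<Longrightarrow> good (V - U)"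
  by (auto simp: good_def perimeter_compl double_diff)

text \<open>The column \<open>c\<close> serves as a spine of \<open>U\<close>, and the column \<open>d\<close> as a spine of the complement.\<close>

lemma goodI:
  assumes "ortho U" "perimeter U = 2 * K + 2" "c < L" "\<And>i. i < K \<Longrightarrow> row U i \<noteq> {} \<Longrightarrow> (i, c) \<in> U"
    "d < L" "\<And>i. (i, d) \<notin> U"
  shows "good U"
proof -
  have "conn U" by (rule conn_spine[OF assms(1,3,4)])
  moreover have "conn (V - U)" by (rule conn_spine[OF ortho_compl[OF assms(1)] assms(5)]) (auto simp: mem_V assms)
  ultimately show ?thesis using assms by (auto simp: good_def ortho_def)
qed

text \<open>The second condition says that \<open>G\<close> is a gate, the third that none of its members can be spared.\<close>

definition set_gate :: "vertex set set \<Rightarrow> bool" where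
  "set_gate G \<longleftrightarrow> (\<forall>U\<in>G. good U) \<and> \<not> reach G {} V \<and> (\<forall>U\<in>G. reach (G - {U}) {} V)"

text \<open>Complements reverse the direction, so that paths from the empty set to the torus are
  exchanged among each other.\<close>

lemma link_compl:
  assumes "link X U U'" "X \<subseteq> Pow V" shows "link ((-) V ` X) (V - U') (V - U)"
proof -
  have l: "step U U'" "low U" "low U'" "U \<notin> X" "U' \<notin> X" using assms(1) by (auto simp: link_def)
  have notin: "V - Z \<notin> (-) V ` X" if "Z \<subseteq> V" "Z \<notin> X" for Z
  proof
    assume "V - Z \<in> (-) V ` X"
    then obtain Y where Y: "Y \<in> X" "V - Z = V - Y" by auto
    then have "Z = Y" using that assms(2) by blast
    then show False using Y that by simp
  qed
  obtain x where "x \<in> V" "U - {x} = U' - {x}" using l(1) by (auto simp: step_def)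
  then have "step (V - U') (V - U)" unfolding step_def by (intro bexI[of _ x]) auto
  then show ?thesis using l notin[of U] notin[of U'] unfolding link_def low_def by (auto simp: perimeter_compl)
qed

lemma reach_compl:
  assumes "reach X S T" "X \<subseteq> Pow V" shows "reach ((-) V ` X) (V - T) (V - S)"
  using assms(1)
proof (induction rule: rtranclp_induct)
  case (step T T')
  then show ?case using link_compl[OF step(2) assms(2)] by (metis converse_rtranclp_into_rtranclp)
qed simp

lemma set_gate_compl:
  assumes "set_gate G" shows "set_gate ((-) V ` G)"
proof -
  have G: "G \<subseteq> Pow V" and good: "\<And>U. U \<in> G \<Longrightarrow> good U" using assms by (auto simp: set_gate_def good_def)
  have GG: "(-) V ` (-) V ` G = G" using G by (force simp: image_image double_diff)
  show ?thesis unfolding set_gate_def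
  proof (intro conjI ballI notI)
    show "good U" if "U \<in> (-) V ` G" for U using that good good_compl by auto
  next
    assume "reach ((-) V ` G) {} V"
    then have "reach ((-) V ` (-) V ` G) (V - V) (V - {})" by (rule reach_compl) auto
    then show False using assms GG by (simp add: set_gate_def)
  next
    fix U assume "U \<in> (-) V ` G"
    then obtain Z where Z: "Z \<in> G" "U = V - Z" by auto
    have "reach ((-) V ` (G - {Z})) (V - V) (V - {})"
      by (rule reach_compl) (use assms Z G in \<open>auto simp: set_gate_def\<close>)
    moreover have "(-) V ` (G - {Z}) = (-) V ` G - {U}" using G Z by auto
    ultimately show "reach ((-) V ` G - {U}) {} V" by simp
  qed
qed

lemma good_band_bar:
  assumes f: "flank s j c" and s: "s < L" and j: "1 \<le> j" "j + 1 < L" and h: "1 \<le> h" "h < K"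
  shows "good (band s j \<union> bar c t h)" (is "good ?U")
proof -
  have cn: "c \<notin> arc L s j" using flank_not_mem[OF f] j by simp
  have cL: "c < L" using f by auto
  have o: "ortho ?U" using ortho_band_bar[OF f s] j h by simp
  have "card (insert c (arc L s j)) = Suc j" using cn j by (simp add: card_arc)
  then have "\<not> {..<L} \<subseteq> insert c (arc L s j)" using card_mono[of "insert c (arc L s j)" "{..<L}"] j by auto
  then obtain d where d: "d < L" "d \<noteq> c" "d \<notin> arc L s j" by blast
  have sJ: "s \<in> arc L s j" using s j mem_arc_iff[of 0 L j s] by simp
  have "2 * (card {..<K} + card {c}) \<le> perimeter ?U"
  proof (rule perimeter_ge)
    fix i assume "i \<in> {..<K}"
    then have "(i, s) \<in> ?U" "(i, d) \<notin> ?U" using sJ d by (auto simp: band_def)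
    then show "mixed L (row ?U i)" using s d unfolding mixed_def by blast
  next
    fix y assume y: "y \<in> {c}"
    have cc: "col ?U y = arc K t h" using y cn unfolding col_band_bar by simp
    have "arc K t h \<noteq> {}" "arc K t h \<noteq> {..<K}"
      using card_arc[of h K t] h by (metis card.empty not_one_le_zero less_imp_le, metis card_lessThan nat_neq_iff less_imp_le)
    then show "mixed K (col ?U y)" unfolding cc using arc_subset[OF pos(1), of t h] unfolding mixed_def by blast
  qed (use cL in auto)
  moreover have "low ?U" using low_band_bar[OF f s] j h by simp
  ultimately have "perimeter ?U = 2 * K + 2" by (simp add: low_def)
  then show ?thesis
    by (rule goodI[OF o _ s _ d(1)]) (use sJ d in \<open>auto simp: band_def\<close>)
qed

lemma good_pair:
  assumes s: "s < L" "flank s 1 c" and e: "e < K" and B: "B \<subseteq> {..<K} - {e}" "turns K B \<le> 2" "B \<noteq> {}"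
  shows "good (({..<K} - {e}) \<times> {s} \<union> B \<times> {c})" (is "good ?U")
proof -
  have cL: "c < L" "c \<noteq> s" using flank_1[OF s] by blast+
  have tA: "turns K ({..<K} - {e}) \<le> 2"
    using turns_arc_le_2[of "K - 1" K "Suc e"] arc_minus_1[OF e] by simp
  have o: "ortho ?U" using ortho_pair[OF s _ tA] B by auto
  define d :: nat where "d = (if 0 \<noteq> s \<and> 0 \<noteq> c then 0 else if 1 \<noteq> s \<and> 1 \<noteq> c then 1 else 2)"
  have d: "d < L" "d \<noteq> s" "d \<noteq> c" using K_ge_3 K_less_L by (auto simp: d_def)
  have e': "\<exists>a<K. a \<noteq> e" using K_ge_3 by (intro exI[of _ "if e = 0 then 1 else 0"]) auto
  have "2 * (card ({..<K} - {e}) + card {s, c}) \<le> perimeter ?U"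
  proof (rule perimeter_ge)
    fix i assume "i \<in> {..<K} - {e}"
    then have "(i, s) \<in> ?U" "(i, d) \<notin> ?U" using d by auto
    then show "mixed L (row ?U i)" using s(1) d(1) unfolding mixed_def by blast
  next
    fix y assume y: "y \<in> {s, c}"
    have "(e, y) \<notin> ?U" using B by auto
    moreover have "\<exists>a<K. (a, y) \<in> ?U" using y e' B by blast
    ultimately show "mixed K (col ?U y)" using e unfolding mixed_def by blast
  qed (use cL s in auto)
  moreover have "low ?U" using low_pair[OF s e _ tA B(1,2)] by simp
  ultimately have "perimeter ?U = 2 * K + 2" using cL e K_ge_3 by (simp add: low_def)
  then show ?thesis
    by (rule goodI[OF o _ s(1) _ d(1)]) (use B d in auto)
qed

text \<open>A growing path meets each size only once up to repetition, so no other member of \<open>G\<close> can lie on it.\<close>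

lemma reach_through:
  assumes "climb {} U" "climb U V" "U \<subseteq> V" and card: "\<And>Z. Z \<in> G \<Longrightarrow> Z \<subseteq> V \<Longrightarrow> card Z = card U"
  shows "reach (G - {U}) {} V"
proof -
  have "reach (G - {U}) {} U"
  proof (rule reach_climb[OF assms(1)])
    fix Z assume "Z \<subseteq> U"
    then show "Z \<notin> G - {U}" using card[of Z] assms(3) card_subset_eq[of U Z] finite_sub[of U] by auto
  qed
  moreover have "reach (G - {U}) U V"
  proof (rule reach_climb[OF assms(2)])
    fix Z assume "U \<subseteq> Z" "Z \<subseteq> V"
    then show "Z \<notin> G - {U}" using card[of Z] card_subset_eq[of Z U] finite_sub[of Z] by auto
  qed
  ultimately show ?thesis by (rule rtranclp_trans)
qed

lemma bars_fullE:
  assumes "U \<in> bars h j K" "h \<le> K"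
  obtains s t c where "s < L" "t < K" "flank s j c" "U = band s j \<union> bar c t h"
  using assms(1) unfolding bars_full[OF assms(2)] by (elim exE conjE) (rule that)

lemma card_bars_full:
  assumes "U \<in> bars h j K" "j < L" "h \<le> K" shows "card U = K * j + h"
proof -
  obtain s t c where "flank s j c" "U = band s j \<union> bar c t h" using bars_fullE[OF assms(1,3)] by metis
  then show ?thesis using card_band_bar[of j h c s t] flank_not_mem[of c s j] assms by simp
qed

lemma set_gate_bars:
  assumes j: "1 \<le> j" "j \<le> L - 3" and h: "1 \<le> h" "h < K" and big: "2 * K - 1 \<le> K * j + h"
  shows "set_gate (bars h j K)"
  unfolding set_gate_def
proof (intro conjI ballI)
  show "\<not> reach (bars h j K) {} V" by (rule bars_separate) fact+
  have jL: "j < L" "j + 1 < L" "h \<le> K" using j h K_less_L K_ge_3 by auto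
  fix U assume U: "U \<in> bars h j K"
  obtain s t c where st: "s < L" "t < K" "flank s j c" "U = band s j \<union> bar c t h"
    using U jL(3) by (rule bars_fullE)
  show g: "good U" unfolding st(4) using st j h jL by (intro good_band_bar) auto
  show "reach (bars h j K - {U}) {} V"
  proof (rule reach_through)
    show "climb {} U" "climb U V" unfolding st(4) using st jL by (intro climb_empty_band_bar climb_band_bar_V; simp)+
    show "U \<subseteq> V" using g by (simp add: good_def)
  qed (use card_bars_full[OF _ jL(1,3)] U in auto)
qed

lemma insert_pair: "e < K \<Longrightarrow> s < L \<Longrightarrow>
  insert (e, s) (({..<K} - {e}) \<times> {s} \<union> B \<times> {c}) = band s 1 \<union> B \<times> {c}"
  by (auto simp: band_def arc_1)

lemma climb_pair_V:
  assumes s: "s < L" "flank s 1 c" and e: "e < K" and B: "arc K b h \<subseteq> {..<K} - {e}" "h \<le> K"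
  shows "climb (({..<K} - {e}) \<times> {s} \<union> bar c b h) (band s 1 \<union> bar c b h)"
    "climb (band s 1 \<union> bar c b h) V"
proof -
  have 1: "1 < L" using K_ge_3 K_less_L by simp
  have tA: "turns K ({..<K} - {e}) \<le> 2"
    using turns_arc_le_2[of "K - 1" K "Suc e"] arc_minus_1[OF e] by simp
  show "climb (({..<K} - {e}) \<times> {s} \<union> bar c b h) (band s 1 \<union> bar c b h)"
    unfolding insert_pair[OF e s(1), symmetric]
  proof (rule climb_insert)
    show "low (({..<K} - {e}) \<times> {s} \<union> bar c b h)"
      using low_pair[OF s e _ tA B(1) turns_arc_le_2[OF B(2)]] by simp
    show "low (insert (e, s) (({..<K} - {e}) \<times> {s} \<union> bar c b h))"
      unfolding insert_pair[OF e s(1)] by (rule low_band_bar[OF s(2,1) 1 B(2)])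
  qed
  show "climb (band s 1 \<union> bar c b h) V" by (rule climb_band_bar_V[OF s(2,1) 1 B(2)])
qed

lemma set_gate_Q_family: "set_gate (rects 2 (K - 1) \<union> bars (K - 2) 1 K)" (is "set_gate ?G")
  unfolding set_gate_def
proof (intro conjI ballI)
  show "\<not> reach ?G {} V" by (rule Q_family_separates)
  have jL: "1 < L" "1 + 1 < L" "K - 2 \<le> K" using K_less_L K_ge_3 by auto
  have card_rect: "card Z = 2 * K - 2" if Z: "Z \<in> rects 2 (K - 1)" for Z
  proof -
    obtain e s where z: "e < K" "s < L" "Z = ({..<K} - {e}) \<times> {s, Suc s mod L}"
      using Z unfolding rects_short by (elim exE conjE) (rule that)
    have "Suc s mod L \<noteq> s" using flank_1[of s "Suc s mod L"] z(2) by simp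
    then show ?thesis using z by (simp add: card_cartesian_product)
  qed
  have card_all: "card Z = 2 * K - 2" if "Z \<in> ?G" for Z
    using that card_rect[of Z] card_bars_full[of Z "K - 2" 1] jL K_ge_3 by auto
  fix U assume U: "U \<in> ?G"
  have "good U \<and> climb {} U \<and> climb U V"
  proof (cases "U \<in> rects 2 (K - 1)")
    case True
    then obtain e s where es: "e < K" "s < L" "U = ({..<K} - {e}) \<times> {s, Suc s mod L}"
      unfolding rects_short by blast
    let ?c = "Suc s mod L"
    have f: "flank s 1 ?c" by simp
    have U: "U = ({..<K} - {e}) \<times> {s} \<union> ({..<K} - {e}) \<times> {?c}" using es(3) by auto
    have a: "{..<K} - {e} = arc K (Suc e) (K - 1)" using arc_minus_1[OF es(1)] .
    have ne: "{..<K} - {e} \<noteq> {}" using card_arc[of "K - 1" K "Suc e"] K_ge_3 unfolding a by auto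
    have t: "turns K ({..<K} - {e}) \<le> 2" unfolding a by (rule turns_arc_le_2) simp
    have "good U" unfolding U using es(2) f es(1) subset_refl t ne by (rule good_pair)
    moreover have "climb {} U" unfolding U unfolding a using a
      by (intro climb_empty_pair[OF es(2) f es(1)]) auto
    moreover have "climb U V"
    proof -
      have "arc K (Suc e) (K - 1) \<subseteq> {..<K} - {e}" using a by simp
      from climb_pair_V[OF es(2) f es(1) this] show ?thesis
        unfolding U a[symmetric] using climb_trans by simp
    qed
    ultimately show ?thesis by simp
  next
    case False
    then have "U \<in> bars (K - 2) 1 K" using U by blast
    then obtain s t c where st: "s < L" "t < K" "flank s 1 c" "U = band s 1 \<union> bar c t (K - 2)"
      using jL(3) by (rule bars_fullE)
    have "good U" unfolding st(4) by (rule good_band_bar[OF st(3,1)]) (use jL K_ge_3 in auto)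
    then show ?thesis unfolding st(4)
      using climb_empty_band_bar[OF st(3,1) jL(1,3)] climb_band_bar_V[OF st(3,1) jL(1,3)] by simp
  qed
  then show "good U" "reach (?G - {U}) {} V"
    using reach_through[of U ?G] card_all U by (auto simp: good_def)
qed

lemma bars_shortE:
  assumes "Z \<in> bars h 1 (K - 1)"
  obtains e s c d where "e < K" "s < L" "flank s 1 c" "d + h \<le> K - 1"
    "Z = ({..<K} - {e}) \<times> {s} \<union> bar c (Suc e + d) h" "arc K (Suc e + d) h \<subseteq> {..<K} - {e}"
proof -
  obtain e s d c where z: "e < K" "s < L" "d + h \<le> K - 1" "flank s 1 c"
    "Z = ({..<K} - {e}) \<times> {s} \<union> bar c (Suc e + d) h"
    using assms unfolding bars_short by (elim exE conjE) (rule that, simp_all)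
  have "arc K (Suc e + d) h \<subseteq> arc K (Suc e) (K - 1)"
  proof
    fix x assume "x \<in> arc K (Suc e + d) h"
    then obtain k where "k < h" "x = (Suc e + (d + k)) mod K" by (auto simp: arc_def add.assoc)
    then show "x \<in> arc K (Suc e) (K - 1)" using z(3) unfolding arc_def by (intro image_eqI[of _ _ "d + k"]) auto
  qed
  then show ?thesis using that[OF z(1,2,4,3,5)] unfolding arc_minus_1[OF z(1)] by blast
qed

text \<open>The members with a full column have \<open>K + i\<close> cells and no empty row; the others have at least \<open>K + i\<close> cells
  and exactly one empty row. Hence a growing path avoids the family as long as it has two empty rows or fewer than
  \<open>K + i\<close> cells, and again once it has no empty row and more than \<open>K + i\<close> cells.\<close>

lemma set_gate_H_family:
  assumes i: "1 \<le> i" "i \<le> K - 3"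
  shows "set_gate (bars i 1 K \<union> (\<Union>h\<in>{i + 1..K - 2}. bars h 1 (K - 1)))" (is "set_gate ?G")
  unfolding set_gate_def
proof (intro conjI ballI)
  show "\<not> reach ?G {} V" by (rule H_family_separates[OF i])
  have K4: "4 \<le> K" using i by simp
  have jL: "1 < L" "1 + 1 < L" "i \<le> K" using K_less_L i K_ge_3 by auto
  have full_rows: "row Z a \<noteq> {}" if "Z \<in> bars i 1 K" "a < K" for Z a
    using that by (auto simp: bars_full[OF jL(3)] band_def arc_1)
  have card_full: "card Z = K + i" if "Z \<in> bars i 1 K" for Z
    using card_bars_full[OF that jL(1,3)] by simp
  \<comment> \<open>Each member of the family contains some column up to at most one cell, so it has at most one empty row.\<close>
  have sparse_notin: "Z \<notin> ?G" if "a < K" "b < K" "a \<noteq> b" "row Z a = {}" "row Z b = {}" for Z a b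
  proof
    assume "Z \<in> ?G"
    then consider "Z \<in> bars i 1 K" | h where "h \<in> {i + 1..K - 2}" "Z \<in> bars h 1 (K - 1)" by blast
    then show False
    proof cases
      case 1 then show ?thesis using full_rows that by blast
    next
      case 2
      obtain e s c d where "Z = ({..<K} - {e}) \<times> {s} \<union> bar c (Suc e + d) h"
        using bars_shortE[OF 2(2)] by metis
      then have "(a, s) \<in> Z \<or> (b, s) \<in> Z" using that(1-3) by auto
      then show ?thesis using that by blast
    qed
  qed
  have full_notin: "Z \<in> bars i 1 K" if rows: "\<And>a. a < K \<Longrightarrow> row Z a \<noteq> {}" and ZG: "Z \<in> ?G" for Z
  proof (rule ccontr)
    assume "Z \<notin> bars i 1 K"
    then obtain h where h: "Z \<in> bars h 1 (K - 1)" using ZG by blast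
    obtain e s c d where z: "e < K" "Z = ({..<K} - {e}) \<times> {s} \<union> bar c (Suc e + d) h"
      "arc K (Suc e + d) h \<subseteq> {..<K} - {e}" using bars_shortE[OF h] by metis
    then have "row Z e = {}" by auto
    then show False using rows z(1) by blast
  qed
  fix U assume U: "U \<in> ?G"
  have "good U \<and> reach (?G - {U}) {} V"
  proof (cases "U \<in> bars i 1 K")
    case True
    then obtain s t c where st: "s < L" "t < K" "flank s 1 c" "U = band s 1 \<union> bar c t i"
      using jL(3) by (rule bars_fullE)
    have g: "good U" unfolding st(4) by (rule good_band_bar[OF st(3,1)]) (use jL i K_ge_3 in auto)
    have fU: "finite U" using g finite_sub by (simp add: good_def)
    have "reach (?G - {U}) {} U"
    proof (rule reach_climb)
      show "climb {} U" unfolding st(4) by (rule climb_empty_band_bar[OF st(3,1) jL(1,3)])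
      fix Z assume Z: "Z \<subseteq> U"
      show "Z \<notin> ?G - {U}"
      proof
        assume ZG: "Z \<in> ?G - {U}"
        have "K + i \<le> card Z"
        proof (cases "Z \<in> bars i 1 K")
          case False
          then obtain h where h: "h \<in> {i + 1..K - 2}" "Z \<in> bars h 1 (K - 1)" using ZG by blast
          obtain e s c d where z: "e < K" "s < L" "flank s 1 c"
            "Z = ({..<K} - {e}) \<times> {s} \<union> bar c (Suc e + d) h" using bars_shortE[OF h(2)] by metis
          have "c \<noteq> s" using flank_1[OF z(2,3)] by blast
          then have "card Z = card (({..<K} - {e}) \<times> {s}) + card (bar c (Suc e + d) h)"
            unfolding z(4) by (intro card_Un_disjoint) auto
          moreover have "card (arc K (Suc e + d) h) = h" using h(1) by (intro card_arc) auto
          moreover have "i < h" using h(1) by simp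
          ultimately show ?thesis using z(1) by (simp add: card_cartesian_product)
        qed (use card_full in simp)
        moreover have "card U = K + i" using card_full[OF True] .
        moreover have "card Z < card U" using Z ZG fU by (intro psubset_card_mono) auto
        ultimately show False by simp
      qed
    qed
    moreover have "reach (?G - {U}) U V"
    proof (rule reach_climb)
      show "climb U V" unfolding st(4) by (rule climb_band_bar_V[OF st(3,1) jL(1,3)])
      fix Z assume Z: "U \<subseteq> Z" "Z \<subseteq> V"
      show "Z \<notin> ?G - {U}"
      proof
        assume ZG: "Z \<in> ?G - {U}"
        have "row Z a \<noteq> {}" if "a < K" for a using full_rows[OF True that] Z by blast
        then have "Z \<in> bars i 1 K" using full_notin ZG by blast
        then have "card Z = card U" using card_full True by simp
        then show False using card_subset_eq[of Z U] finite_sub[of Z] Z ZG by auto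
      qed
    qed
    ultimately have "reach (?G - {U}) {} V" by (rule rtranclp_trans)
    then show ?thesis using g by simp
  next
    case False
    then obtain h where h: "h \<in> {i + 1..K - 2}" "U \<in> bars h 1 (K - 1)" using U by blast
    obtain e s c d where z': "e < K" "s < L" "flank s 1 c" "d + h \<le> K - 1"
            "U = ({..<K} - {e}) \<times> {s} \<union> bar c (Suc e + d) h"
            and B: "arc K (Suc e + d) h \<subseteq> {..<K} - {e}"
      using bars_shortE[OF h(2)] by metis
    have "i < h" "h \<le> K - 2" using h(1) by auto
    note z = z'(1-3) this z'(4,5)
    let ?A = "{..<K} - {e}" let ?B = "arc K (Suc e + d) h"
    have cs: "c < L" "c \<noteq> s" using flank_1[OF z(2,3)] by blast+
    have hK: "h \<le> K" using z by simp
    have A: "?A = arc K (Suc e) (K - 1)" using arc_minus_1[OF z(1)] .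
    have tA: "turns K ?A \<le> 2" unfolding A by (rule turns_arc_le_2) simp
    have tB: "turns K ?B \<le> 2" using hK by (rule turns_arc_le_2)
    have "?B \<noteq> {}" using card_arc[OF hK, of "Suc e + d"] z by (metis card.empty not_less_zero)
    then have g: "good U" unfolding z(7) by (intro good_pair[OF z(2,3,1) B tB])
    \<comment> \<open>As \<open>h \<le> K - 2\<close>, one of the two ends \<open>w\<close> of the long column is not flanked by the bar. Without it the
      set has the empty rows \<open>e\<close> and \<open>w\<close>.\<close>
    obtain w a where w: "w \<in> ?A" "w \<notin> ?B" "?A = insert w (arc K a (K - 2))" "w \<notin> arc K a (K - 2)"
    proof -
      have K2: "K - 1 = Suc (K - 2)" using K4 by simp
      show ?thesis
      proof (cases "d = 0")
        case True
        let ?w = "(Suc e + (K - 2)) mod K"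
        have "?w \<notin> ?B" using mem_arc_iff[of "K - 2" K h "Suc e"] True z K4 by simp
        moreover have "?A = insert ?w (arc K (Suc e) (K - 2))" unfolding A K2 by (rule arc_Suc)
        moreover have "?w \<notin> arc K (Suc e) (K - 2)" using mem_arc_iff[of "K - 2" K "K - 2" "Suc e"] K4 by simp
        ultimately show ?thesis using that by blast
      next
        case False
        let ?w = "Suc e mod K"
        have "Suc e + d + (K - d) = Suc e + K" using z by simp
        then have "?w = (Suc e + d + (K - d)) mod K" by (simp only: mod_add_self2)
        then have "?w \<notin> ?B" using mem_arc_iff[of "K - d" K h "Suc e + d"] False z K4 by simp
        moreover have "?A = insert ?w (arc K (Suc (Suc e)) (K - 2))"
        proof -
          have "insert ((Suc (Suc e) + K - 1) mod K) (arc K (Suc (Suc e)) (K - 2)) = arc K (Suc (Suc e) + K - 1) (Suc (K - 2))"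
            by (rule insert_left_arc[OF pos(1)])
          moreover have "Suc (Suc e) + K - 1 = Suc e + K" by simp
          moreover have "arc K (Suc e + K) (Suc (K - 2)) = arc K (Suc e) (Suc (K - 2))"
            by (metis arc_mod mod_add_self2)
          moreover have "(Suc e + K) mod K = Suc e mod K" by (rule mod_add_self2)
          ultimately show ?thesis unfolding A K2 by simp
        qed
        moreover have "?w \<notin> arc K (Suc (Suc e)) (K - 2)"
        proof -
          have "Suc (Suc e) + (K - 1) = Suc e + K" using K4 by simp
          then have "?w = (Suc (Suc e) + (K - 1)) mod K" by (simp only: mod_add_self2)
          then show ?thesis using mem_arc_iff[of "K - 1" K "K - 2" "Suc (Suc e)"] K4 by simp
        qed
        ultimately show ?thesis using that by blast
      qed
    qed
    let ?U0 = "arc K a (K - 2) \<times> {s} \<union> ?B \<times> {c}"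
    have sub0: "arc K a (K - 2) \<subseteq> ?A" using w(3) by blast
    have eqU: "U = insert (w, s) ?U0" unfolding z(7) w(3) by auto
    have "reach (?G - {U}) {} ?U0"
    proof (rule reach_climb)
      show "climb {} ?U0" by (rule climb_empty_pair[OF z(2,3,1) sub0 _ B hK]) simp
      fix Z assume Z: "Z \<subseteq> ?U0"
      have "row Z e = {}" "row Z w = {}" using Z sub0 B w(2,4) by blast+
      then show "Z \<notin> ?G - {U}" using sparse_notin[of e w Z] w(1) z(1) by auto
    qed
    moreover have "reach (?G - {U}) ?U0 U"
    proof (rule reach_climb)
      have "low ?U0" by (rule low_pair[OF z(2,3,1) sub0 _ B tB]) (simp add: turns_arc_le_2)
      moreover have "low U" using g by (simp add: good_def low_def)
      ultimately show "climb ?U0 U" unfolding eqU by (rule climb_insert)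
      fix Z assume Z: "?U0 \<subseteq> Z" "Z \<subseteq> U"
      show "Z \<notin> ?G - {U}"
      proof (cases "Z = U")
        case False
        then have "Z \<subseteq> ?U0" using Z eqU by blast
        then have "row Z e = {}" "row Z w = {}" using sub0 B w(2,4) by blast+
        then show ?thesis using sparse_notin[of e w Z] w(1) z(1) by auto
      qed simp
    qed
    moreover have "reach (?G - {U}) U (band s 1 \<union> bar c (Suc e + d) h)"
      and "reach (?G - {U}) (band s 1 \<union> bar c (Suc e + d) h) V"
    proof -
      let ?T = "band s 1 \<union> bar c (Suc e + d) h"
      have T: "?T = insert (e, s) U" unfolding z(7) insert_pair[OF z(1,2)] ..
      have beyond: "Z \<notin> ?G" if "?T \<subseteq> Z" "Z \<subseteq> V" for Z
      proof
        assume "Z \<in> ?G"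
        moreover have "row Z a \<noteq> {}" if "a < K" for a
          using that \<open>?T \<subseteq> Z\<close> z(2) by (auto simp: band_def arc_1)
        ultimately have "Z \<in> bars i 1 K" using full_notin by blast
        then have "card Z = K + i" by (rule card_full)
        moreover have "card ?T = K + h"
          using card_band_bar[of 1 h c s] flank_not_mem[OF z(3) jL(1)] hK jL by simp
        moreover have "card ?T \<le> card Z" using that finite_sub by (intro card_mono) auto
        ultimately show False using z by simp
      qed
      note cl = climb_pair_V[OF z(2,3,1) B hK]
      have TV: "?T \<subseteq> V" using climb_subset[OF cl(2)] .
      show "reach (?G - {U}) U ?T"
      proof (rule reach_climb)
        show "climb U ?T" unfolding z(7) by (rule cl(1))
        fix Z assume Z: "U \<subseteq> Z" "Z \<subseteq> ?T"
        then have "Z \<subseteq> insert (e, s) U" using T by simp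
        then have "Z = U \<or> Z = ?T" unfolding T using Z(1) by (cases "(e, s) \<in> Z") blast+
        then show "Z \<notin> ?G - {U}" using beyond[of ?T] TV by blast
      qed
      show "reach (?G - {U}) ?T V"
        by (rule reach_climb[OF cl(2)]) (use beyond in blast)
    qed
    ultimately have "reach (?G - {U}) {} V" 
      by (rule rtranclp_trans[OF rtranclp_trans[OF rtranclp_trans]])
    then show ?thesis using g by simp
  qed
  then show "good U" "reach (?G - {U}) {} V" by blast+
qed

section \<open>From vertex sets to configurations\<close>

definition right :: "vertex \<Rightarrow> vertex" where "right x = (fst x, Suc (snd x) mod L)"

definition down :: "vertex \<Rightarrow> vertex" where "down x = (Suc (fst x) mod K, snd x)"

lemma right_V: "x \<in> V \<Longrightarrow> right x \<in> V" and down_V: "x \<in> V \<Longrightarrow> down x \<in> V"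
  by (auto simp: right_def down_def vertices_def)

definition disagreements :: "config \<Rightarrow> nat" where
  "disagreements \<sigma> = (\<Sum>x\<in>V. of_bool (\<sigma> x \<noteq> \<sigma> (right x)) + of_bool (\<sigma> x \<noteq> \<sigma> (down x)))"

lemma edges_eq: "edges K L = (\<lambda>x. {x, right x}) ` V \<union> (\<lambda>x. {x, down x}) ` V"
proof -
  have "{{(i, j), (i, (j + 1) mod L)} | i j. i < K \<and> j < L} = (\<lambda>x. {x, right x}) ` V"
    by (force simp: right_def vertices_def image_iff)
  moreover have "{{(i, j), ((i + 1) mod K, j)} | i j. i < K \<and> j < L} = (\<lambda>x. {x, down x}) ` V"
    by (force simp: down_def vertices_def image_iff)
  ultimately show ?thesis unfolding edges_def by simp
qed

text \<open>Distinct vertices have distinct edges to the right as \<open>L \<ge> 3\<close>; on a cycle of length two both edges would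
  coincide.\<close>

lemma inj_right: "inj_on (\<lambda>x. {x, right x}) V"
  using K_ge_3 K_less_L
  by (auto simp: inj_on_def right_def vertices_def doubleton_eq_iff mod_Suc split: if_splits)

lemma inj_down: "inj_on (\<lambda>x. {x, down x}) V"
  using K_ge_3
  by (auto simp: inj_on_def down_def vertices_def doubleton_eq_iff mod_Suc split: if_splits)

lemma right_down_disjoint: "(\<lambda>x. {x, right x}) ` V \<inter> (\<lambda>x. {x, down x}) ` V = {}"
  using K_ge_3 K_less_L
  by (auto simp: right_def down_def vertices_def doubleton_eq_iff mod_Suc split: if_splits)

text \<open>The torus has \<open>2 K L\<close> edges.\<close>

lemma energy_eq: "energy K L \<sigma> = int (disagreements \<sigma>) - 2 * int (K * L)"
proof -
  have agree: "(\<Sum>x\<in>V. of_bool (\<sigma> x = \<sigma> (f x)) :: int) = int (K * L) - (\<Sum>x\<in>V. of_bool (\<sigma> x \<noteq> \<sigma> (f x)))" for f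
  proof -
    have "(\<Sum>x\<in>V. of_bool (\<sigma> x = \<sigma> (f x)) :: int) = (\<Sum>x\<in>V. 1 - of_bool (\<sigma> x \<noteq> \<sigma> (f x)))"
      by (rule sum.cong) auto
    then show ?thesis by (simp add: sum_subtractf card_V)
  qed
  have img: "(\<Sum>e\<in>(\<lambda>x. {x, f x}) ` V. of_bool (\<forall>v\<in>e. \<forall>w\<in>e. \<sigma> v = \<sigma> w) :: int) = (\<Sum>x\<in>V. of_bool (\<sigma> x = \<sigma> (f x)))"
    if "inj_on (\<lambda>x. {x, f x}) V" for f
    unfolding sum.reindex[OF that] comp_def by (rule sum.cong) (auto simp: eq_commute)
  have "(\<Sum>e\<in>edges K L. of_bool (\<forall>v\<in>e. \<forall>w\<in>e. \<sigma> v = \<sigma> w) :: int) =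
      (\<Sum>x\<in>V. of_bool (\<sigma> x = \<sigma> (right x))) + (\<Sum>x\<in>V. of_bool (\<sigma> x = \<sigma> (down x)))"
    unfolding edges_eq sum.union_disjoint[OF finite_imageI[OF finite_V] finite_imageI[OF finite_V] right_down_disjoint]
      img[OF inj_right] img[OF inj_down] ..
  then have "energy K L \<sigma> = - ((\<Sum>x\<in>V. of_bool (\<sigma> x = \<sigma> (right x))) + (\<Sum>x\<in>V. of_bool (\<sigma> x = \<sigma> (down x))))"
    unfolding energy_def by simp
  then show ?thesis unfolding agree by (simp add: disagreements_def sum.distrib)
qed

lemma turns_sum: "turns N X = (\<Sum>i<N. of_bool ((i \<in> X) \<noteq> (Suc i mod N \<in> X)))"
proof -
  have "{..<N} \<inter> {i. (i \<in> X) \<noteq> (Suc i mod N \<in> X)} = {i. i < N \<and> (i \<in> X) \<noteq> (Suc i mod N \<in> X)}" by auto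
  then show ?thesis by (simp add: turns_def sum_of_bool_eq)
qed

lemma perimeter_sum: "perimeter U = (\<Sum>x\<in>V. of_bool ((x \<in> U) \<noteq> (right x \<in> U)) + of_bool ((x \<in> U) \<noteq> (down x \<in> U)))"
proof -
  have V: "V = {..<K} \<times> {..<L}" by (auto simp: vertices_def)
  have "(\<Sum>i<K. turns L (row U i)) = (\<Sum>x\<in>V. of_bool ((x \<in> U) \<noteq> (right x \<in> U)))"
    unfolding turns_sum V sum.cartesian_product by (rule sum.cong) (auto simp: right_def)
  moreover have "(\<Sum>j<L. turns K (col U j)) = (\<Sum>x\<in>V. of_bool ((x \<in> U) \<noteq> (down x \<in> U)))"
    unfolding turns_sum V by (subst sum.swap, subst sum.cartesian_product, rule sum.cong) (auto simp: down_def)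
  ultimately show ?thesis by (simp add: perimeter_def sum.distrib)
qed

text \<open>The vertices at which the starting spin \<open>r\<close> has been abandoned, whatever the new spins are.\<close>

definition supp :: "nat \<Rightarrow> config \<Rightarrow> vertex set" where
  "supp r \<sigma> = {v \<in> V. \<sigma> v \<noteq> r}"

lemma mem_supp: "v \<in> V \<Longrightarrow> v \<in> supp r \<sigma> \<longleftrightarrow> \<sigma> v \<noteq> r" by (simp add: supp_def)

text \<open>Identifying all spins other than \<open>r\<close> cannot create disagreements.\<close>

lemma perimeter_supp_le: "perimeter (supp r \<sigma>) \<le> disagreements \<sigma>"
  unfolding perimeter_sum disagreements_def by (rule sum_mono, rule add_mono) (auto simp: mem_supp right_V down_V)

text \<open>In the case of equality no two adjacent cells of the support disagree.\<close>

lemma agree_if_perimeter_eq: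
  assumes eq: "perimeter (supp r \<sigma>) = disagreements \<sigma>" and x: "x \<in> supp r \<sigma>"
  shows "right x \<in> supp r \<sigma> \<Longrightarrow> \<sigma> x = \<sigma> (right x)" "down x \<in> supp r \<sigma> \<Longrightarrow> \<sigma> x = \<sigma> (down x)"
proof -
  let ?U = "supp r \<sigma>"
  let ?f = "\<lambda>x. of_bool ((x \<in> ?U) \<noteq> (right x \<in> ?U)) + of_bool ((x \<in> ?U) \<noteq> (down x \<in> ?U)) :: nat"
  let ?g = "\<lambda>x. of_bool (\<sigma> x \<noteq> \<sigma> (right x)) + of_bool (\<sigma> x \<noteq> \<sigma> (down x)) :: nat"
  have xV: "x \<in> V" using x by (simp add: supp_def)
  have le: "?f y \<le> ?g y" if "y \<in> V" for y
    by (rule add_mono) (use that in \<open>auto simp: mem_supp right_V down_V\<close>)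
  have "\<not> ?f x < ?g x"
  proof
    assume "?f x < ?g x"
    then have "(\<Sum>x\<in>V. ?f x) < (\<Sum>x\<in>V. ?g x)" 
      by (intro sum_strict_mono_ex1 finite_V ballI le bexI[of _ x] xV)
    then show False using eq by (simp add: perimeter_sum disagreements_def)
  qed
  then have "?f x = ?g x" using le[OF xV] by simp
  then show "right x \<in> ?U \<Longrightarrow> \<sigma> x = \<sigma> (right x)" "down x \<in> ?U \<Longrightarrow> \<sigma> x = \<sigma> (down x)"
    using x xV by (auto simp: mem_supp right_V down_V of_bool_def split: if_splits)
qed

lemma two_spin_eq: "v \<in> V \<Longrightarrow> two_spin K L U r t v = (if v \<in> U then t else r)"
  by (simp add: two_spin_def)

lemma supp_two_spin: "U \<subseteq> V \<Longrightarrow> r \<noteq> t \<Longrightarrow> supp r (two_spin K L U r t) = U"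
  by (auto simp: supp_def two_spin_eq split: if_splits)

lemma disagreements_two_spin: "r \<noteq> t \<Longrightarrow> disagreements (two_spin K L U r t) = perimeter U"
  unfolding perimeter_sum disagreements_def by (rule sum.cong) (auto simp: two_spin_eq right_V down_V)

lemma two_spin_compl: "two_spin K L U t r = two_spin K L (V - U) r t"
  by (auto simp: two_spin_def)

lemma two_spin_empty: "two_spin K L {} r t = const_config K L r"
  by (simp add: two_spin_def const_config_def)

lemma two_spin_V: "two_spin K L V r t = const_config K L t"
  by (auto simp: two_spin_def const_config_def)

lemma two_spin_configs: "r \<in> spins q \<Longrightarrow> t \<in> spins q \<Longrightarrow> two_spin K L U r t \<in> configs q K L"
  by (auto simp: configs_def two_spin_def)

lemma finite_diff_set: "finite (diff_set K L \<sigma> \<sigma>')"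
  unfolding diff_set_def by simp

lemma step_supp:
  assumes "0 < conn_matrix q K L \<sigma> \<sigma>'" shows "step (supp r \<sigma>) (supp r \<sigma>')"
proof -
  have "card (diff_set K L \<sigma> \<sigma>') \<le> 1" using assms by (auto simp: conn_matrix_def split: if_splits)
  then have "\<exists>x\<in>V. diff_set K L \<sigma> \<sigma>' \<subseteq> {x}"
  proof (cases "card (diff_set K L \<sigma> \<sigma>') = 0")
    case True
    then have "diff_set K L \<sigma> \<sigma>' = {}" using finite_diff_set by simp
    moreover have "(0, 0) \<in> V" by (simp add: mem_V)
    ultimately show ?thesis by blast
  next
    case False
    then have "card (diff_set K L \<sigma> \<sigma>') = 1" using \<open>card (diff_set K L \<sigma> \<sigma>') \<le> 1\<close> by simp
    then obtain x where "diff_set K L \<sigma> \<sigma>' = {x}" by (rule card_1_singletonE)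
    moreover have "x \<in> V" using calculation by (auto simp: diff_set_def)
    ultimately show ?thesis by blast
  qed
  then obtain x where x: "x \<in> V" "diff_set K L \<sigma> \<sigma>' \<subseteq> {x}" by blast
  have "supp r \<sigma> - {x} = supp r \<sigma>' - {x}" using x(2) by (auto simp: supp_def diff_set_def)
  then show ?thesis using x(1) by (auto simp: step_def)
qed

lemma conn_matrix_two_spin:
  assumes "step U U'" "0 < q"
  shows "0 < conn_matrix q K L (two_spin K L U r t) (two_spin K L U' r t)"
proof -
  obtain x where x: "x \<in> V" "U - {x} = U' - {x}" using assms by (auto simp: step_def)
  have "diff_set K L (two_spin K L U r t) (two_spin K L U' r t) \<subseteq> {x}"
  proof -
    have "two_spin K L U r t y = two_spin K L U' r t y" if "y \<in> V" "y \<noteq> x" for y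
    proof -
      have "y \<in> U \<longleftrightarrow> y \<in> U'" using x(2) that(2) by blast
      then show ?thesis using that(1) by (simp add: two_spin_eq)
    qed
    then show ?thesis unfolding diff_set_def by blast
  qed
  then have "card (diff_set K L (two_spin K L U r t) (two_spin K L U' r t)) \<le> 1"
    using card_mono[of "{x}"] by fastforce
  moreover have "card V > 0" by (simp add: card_V)
  ultimately show ?thesis using assms(2) unfolding conn_matrix_def by auto
qed

lemma reach_of_path:
  assumes "\<omega> \<noteq> []" "successively (\<lambda>\<xi> \<eta>. conn_matrix q K L \<xi> \<eta> > 0) \<omega>"
    "\<And>\<sigma>. \<sigma> \<in> set \<omega> \<Longrightarrow> disagreements \<sigma> \<le> 2 * K + 2 \<and> supp r \<sigma> \<notin> X"
  shows "reach X (supp r (hd \<omega>)) (supp r (last \<omega>))"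
  using assms
proof (induction \<omega> rule: induct_list012)
  case (3 x y zs)
  have l: "low (supp r \<sigma>)" if "\<sigma> \<in> set (x # y # zs)" for \<sigma>
    using "3.prems"(3)[OF that] perimeter_supp_le[of r \<sigma>] by (auto simp: low_def supp_def)
  have "link X (supp r x) (supp r y)"
    unfolding link_def using step_supp[of q x y r] "3.prems" l by auto
  moreover have "reach X (supp r y) (supp r (last (y # zs)))" using "3.IH"(2) "3.prems" by auto
  ultimately show ?case by (simp add: converse_rtranclp_into_rtranclp)
qed auto

lemma path_of_reach:
  assumes "reach X S T" "low S" "S \<notin> X" "0 < q"
  shows "\<exists>\<omega>. \<omega> \<noteq> [] \<and> hd \<omega> = two_spin K L S r t \<and> last \<omega> = two_spin K L T r t \<and>
    successively (\<lambda>\<xi> \<eta>. conn_matrix q K L \<xi> \<eta> > 0) \<omega> \<and>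
    (\<forall>\<sigma>\<in>set \<omega>. \<exists>U. \<sigma> = two_spin K L U r t \<and> low U \<and> U \<notin> X)"
  using assms(1)
proof (induction rule: rtranclp_induct)
  case base
  show ?case using assms by (intro exI[of _ "[two_spin K L S r t]"]) auto
next
  case (step T T')
  then obtain \<omega> where w: "\<omega> \<noteq> []" "hd \<omega> = two_spin K L S r t" "last \<omega> = two_spin K L T r t"
    "successively (\<lambda>\<xi> \<eta>. conn_matrix q K L \<xi> \<eta> > 0) \<omega>"
    "\<forall>\<sigma>\<in>set \<omega>. \<exists>U. \<sigma> = two_spin K L U r t \<and> low U \<and> U \<notin> X" by blast
  have l: "step T T'" "low T'" "T' \<notin> X" using step(2) by (auto simp: link_def)
  show ?case
    using w l conn_matrix_two_spin[OF l(1) assms(4), of r t]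
    by (intro exI[of _ "\<omega> @ [two_spin K L T' r t]"]) (auto simp: successively_append_iff)
qed

lemma reach_empty_V: "reach {} {} V"
proof (rule reach_climb)
  show "climb {} V" using climb_band_V[of 0 0] by (simp add: band_def)
qed simp

lemma low_empty: "low {}" and perimeter_empty: "perimeter {} = 0"
  by (simp_all add: low_def perimeter_def turns_def)

text \<open>A low path of configurations meets \<open>G\<close> in its supports. There the perimeter is already
  \<open>2 K + 2\<close>, so the configuration has no further disagreements and, the support being connected, just
  one new spin \<open>t\<close>. This also bounds the communication height from below. Conversely each path of vertex sets is
  realised by configurations with the spins \<open>r\<close> and \<open>t\<close>.\<close>

lemma minimal_gate_if_set_gate:
  assumes q: "2 \<le> q" and r: "r \<in> spins q" and G: "set_gate G"
  shows "is_minimal_gate q K L (const_config K L r) (stable_configs q K L - {const_config K L r})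
    (\<Union>t\<in>spins q - {r}. {two_spin K L U r t | U. U \<in> G})"
    (is "is_minimal_gate _ _ _ ?R ?A ?W")
proof -
  let ?T = "spins q - {r}"
  define e0 where "e0 = int (2 * K + 2) - 2 * int (K * L)"
  have good: "good U" if "U \<in> G" for U using G that by (simp add: set_gate_def)
  have energy_le: "energy K L \<sigma> \<le> e0 \<longleftrightarrow> disagreements \<sigma> \<le> 2 * K + 2" for \<sigma>
    by (auto simp: energy_eq e0_def)
  have energy_e0: "energy K L \<sigma> = e0 \<longleftrightarrow> disagreements \<sigma> = 2 * K + 2" for \<sigma>
    by (auto simp: energy_eq e0_def)
  have const_inj: "const_config K L t = const_config K L t' \<longleftrightarrow> t = t'" for t t'
  proof
    assume "const_config K L t = const_config K L t'"
    then have "const_config K L t (0, 0) = const_config K L t' (0, 0)" by simp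
    then show "t = t'" by (simp add: const_config_def mem_V)
  qed simp
  have A: "?A = const_config K L ` ?T"
    unfolding stable_configs_def using const_inj by auto
  have "(if r = 1 then 2 else 1) \<in> ?T" using q r by (auto simp: spins_def)
  then have T_ne: "?T \<noteq> {}" by blast
  have supp_R: "supp r ?R = {}" by (auto simp: supp_def const_config_def)
  have supp_t: "supp r (const_config K L t) = V" if "t \<in> ?T" for t
    using that by (auto simp: supp_def const_config_def)

  \<comment> \<open>Equality holds throughout \<open>2 K + 2 = perimeter \<le> disagreements \<le> 2 K + 2\<close>.\<close>
  have hit: "\<exists>\<sigma>\<in>set \<omega>. supp r \<sigma> \<in> G \<and> disagreements \<sigma> = 2 * K + 2 \<and> perimeter (supp r \<sigma>) = disagreements \<sigma>"
    if w: "\<omega> \<in> paths q K L ?R (const_config K L t)" and t: "t \<in> ?T"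
      and low: "\<And>\<sigma>. \<sigma> \<in> set \<omega> \<Longrightarrow> disagreements \<sigma> \<le> 2 * K + 2" for \<omega> t
  proof -
    have "\<exists>\<sigma>\<in>set \<omega>. supp r \<sigma> \<in> G"
    proof (rule ccontr)
      assume "\<not> ?thesis"
      then have "reach G (supp r (hd \<omega>)) (supp r (last \<omega>))"
        using w low by (intro reach_of_path[of \<omega> q]) (auto simp: paths_def)
      then have "reach G {} V" using w supp_R supp_t[OF t] by (simp add: paths_def)
      then show False using G by (simp add: set_gate_def)
    qed
    then obtain \<sigma> where s: "\<sigma> \<in> set \<omega>" "supp r \<sigma> \<in> G" by blast
    have "perimeter (supp r \<sigma>) = 2 * K + 2" using good[OF s(2)] by (simp add: good_def)
    then have "disagreements \<sigma> = 2 * K + 2" "perimeter (supp r \<sigma>) = disagreements \<sigma>" using perimeter_supp_le[of r \<sigma>] low[OF s(1)] by auto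
    then show ?thesis using s by blast
  qed

  have fin: "finite (configs q K L)" by (simp add: configs_def spins_def finite_PiE)
  have height_le: "height K L \<omega> \<le> e0 \<longleftrightarrow> (\<forall>\<sigma>\<in>set \<omega>. disagreements \<sigma> \<le> 2 * K + 2)" if "\<omega> \<noteq> []" for \<omega>
    using that by (simp add: height_def energy_le)
  have height_ge: "e0 \<le> height K L \<omega>" if w: "\<omega> \<in> paths q K L ?R (const_config K L t)" and t: "t \<in> ?T" for \<omega> t
  proof (rule ccontr)
    assume n: "\<not> ?thesis"
    have ne: "\<omega> \<noteq> []" using w by (simp add: paths_def)
    then have "\<forall>\<sigma>\<in>set \<omega>. disagreements \<sigma> \<le> 2 * K + 2" using n height_le[OF ne] by linarith
    then obtain \<sigma> where "\<sigma> \<in> set \<omega>" "disagreements \<sigma> = 2 * K + 2" using hit[OF w t] by blast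
    then have "e0 \<le> height K L \<omega>" unfolding height_def using energy_e0[of \<sigma>] by (intro Max_ge) auto
    then show False using n by simp
  qed
  have ex_path: "\<exists>\<omega>\<in>paths q K L ?R (const_config K L t). height K L \<omega> = e0 \<and>
      (\<forall>\<sigma>\<in>set \<omega>. \<exists>U. \<sigma> = two_spin K L U r t \<and> low U \<and> U \<notin> X)"
    if t: "t \<in> ?T" and X: "reach X {} V" "{} \<notin> X" for t X
  proof -
    obtain \<omega> where w: "\<omega> \<noteq> []" "hd \<omega> = ?R" "last \<omega> = const_config K L t"
      "successively (\<lambda>\<xi> \<eta>. conn_matrix q K L \<xi> \<eta> > 0) \<omega>"
      "\<forall>\<sigma>\<in>set \<omega>. \<exists>U. \<sigma> = two_spin K L U r t \<and> low U \<and> U \<notin> X"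
      using path_of_reach[OF X(1) low_empty X(2), of q r t] q unfolding two_spin_empty two_spin_V by auto
    have p: "\<omega> \<in> paths q K L ?R (const_config K L t)"
      unfolding paths_def using w two_spin_configs[OF r, of t] t by fastforce
    have "\<forall>\<sigma>\<in>set \<omega>. disagreements \<sigma> \<le> 2 * K + 2" using w(5) t disagreements_two_spin[of r t] by (fastforce simp: low_def)
    then have "height K L \<omega> = e0" using height_le[OF w(1)] height_ge[OF p t] by simp
    then show ?thesis using p w(5) by blast
  qed
  have comm: "comm_height q K L ?R (const_config K L t) = e0" if t: "t \<in> ?T" for t
    unfolding comm_height_def
  proof (rule Min_eqI)
    have "height K L ` paths q K L ?R (const_config K L t) \<subseteq> energy K L ` configs q K L"
    proof
      fix y assume "y \<in> height K L ` paths q K L ?R (const_config K L t)"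
      then obtain \<omega> where w: "\<omega> \<noteq> []" "set \<omega> \<subseteq> configs q K L" "y = height K L \<omega>" by (auto simp: paths_def)
      have "Max (energy K L ` set \<omega>) \<in> energy K L ` set \<omega>" using w(1) by (intro Max_in) auto
      then show "y \<in> energy K L ` configs q K L" unfolding w(3) height_def using w(2) by blast
    qed
    then show "finite (height K L ` paths q K L ?R (const_config K L t))" using fin finite_surj by blast
    show "e0 \<in> height K L ` paths q K L ?R (const_config K L t)"
      using ex_path[OF t reach_empty_V] by force
  qed (use height_ge t in auto)
  have "comm_height q K L ?R ` ?A = {e0}" unfolding A image_image using T_ne comm by auto
  then have comm_set: "comm_height_set q K L ?R ?A = e0" by (simp add: comm_height_set_def)
  have opt: "\<omega> \<in> opt_paths q K L ?R ?A \<longleftrightarrow> (\<exists>t\<in>?T. \<omega> \<in> paths q K L ?R (const_config K L t)) \<and> height K L \<omega> = e0" for \<omega>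
    unfolding opt_paths_def comm_set unfolding A by auto

  have WI: "\<sigma> \<in> ?W" if c: "\<sigma> \<in> configs q K L" and U: "supp r \<sigma> \<in> G" and eq: "perimeter (supp r \<sigma>) = disagreements \<sigma>" for \<sigma>
  proof -
    let ?U = "supp r \<sigma>"
    have g: "?U \<subseteq> V" "conn ?U" "perimeter ?U = 2 * K + 2" using good[OF U] by (auto simp: good_def)
    have "?U \<noteq> {}" using g(3) perimeter_empty by auto
    then obtain u where u: "u \<in> ?U" by blast
    have const: "\<sigma> v = \<sigma> u" if "v \<in> ?U" for v
    proof -
      have "\<forall>v\<in>?U. \<forall>w\<in>?U. \<sigma> v = \<sigma> w"
        using g(2) agree_if_perimeter_eq[OF eq] unfolding conn_def right_def down_def by fastforce
      then show ?thesis using u that by blast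
    qed
    have "\<sigma> = two_spin K L ?U r (\<sigma> u)"
    proof (rule extensionalityI[of _ V])
      show "\<sigma> \<in> extensional V" using c by (auto simp: configs_def PiE_def)
      show "two_spin K L ?U r (\<sigma> u) \<in> extensional V" by (simp add: two_spin_def)
      show "\<sigma> v = two_spin K L ?U r (\<sigma> u) v" if "v \<in> V" for v
        using that const[of v] by (simp add: two_spin_eq mem_supp)
    qed
    moreover have "\<sigma> u \<in> ?T" using u c by (auto simp: supp_def configs_def)
    ultimately show ?thesis using U by blast
  qed
  \<comment> \<open>The path of supports meets \<open>G\<close> in \<open>U\<close> only, and all configurations on it have the spins
    \<open>r\<close> and \<open>t\<close>.\<close>
  have only: "\<exists>\<omega>\<in>opt_paths q K L ?R ?A. \<xi> \<in> set \<omega> \<and> set \<omega> \<inter> ?W \<subseteq> {\<xi>}" if xi: "\<xi> \<in> ?W" for \<xi>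
  proof -
    obtain U t where U: "U \<in> G" "t \<in> ?T" "\<xi> = two_spin K L U r t" using xi by blast
    have ne: "{} \<notin> G" using good[of "{}"] perimeter_empty by (auto simp: good_def)
    obtain \<omega> where w: "\<omega> \<in> paths q K L ?R (const_config K L t)" "height K L \<omega> = e0"
      "\<forall>\<sigma>\<in>set \<omega>. \<exists>Z. \<sigma> = two_spin K L Z r t \<and> low Z \<and> Z \<notin> G - {U}"
      using ex_path[OF U(2), of "G - {U}"] G U(1) ne by (auto simp: set_gate_def)
    have o: "\<omega> \<in> opt_paths q K L ?R ?A" unfolding opt using w U(2) by blast
    have rt: "r \<noteq> t" using U(2) by blast
    have *: "\<sigma> = \<xi>" if s: "\<sigma> \<in> set \<omega>" "supp r \<sigma> \<in> G" for \<sigma>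
    proof -
      obtain Z where Z: "\<sigma> = two_spin K L Z r t" "low Z" "Z \<notin> G - {U}"
        using bspec[OF w(3) s(1)] by (elim exE conjE)
      have "supp r \<sigma> = Z" unfolding Z(1) using supp_two_spin[OF _ rt] Z(2) by (simp add: low_def)
      then have "Z = U" using s(2) Z(3) by simp
      then show ?thesis using Z(1) U(3) by simp
    qed
    have "\<omega> \<noteq> []" using w(1) by (simp add: paths_def)
    then have "\<And>\<sigma>. \<sigma> \<in> set \<omega> \<Longrightarrow> disagreements \<sigma> \<le> 2 * K + 2" using height_le w(2) by fastforce
    then have "\<xi> \<in> set \<omega>" using hit[OF w(1) U(2)] * by blast
    moreover have "set \<omega> \<inter> ?W \<subseteq> {\<xi>}"
    proof
      fix \<sigma> assume s: "\<sigma> \<in> set \<omega> \<inter> ?W"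
      then obtain Z t' where "Z \<in> G" "t' \<in> ?T" "\<sigma> = two_spin K L Z r t'" by blast
      then have "supp r \<sigma> \<in> G" using supp_two_spin[of Z r t'] good[of Z] by (auto simp: good_def)
      then show "\<sigma> \<in> {\<xi>}" using * s by blast
    qed
    ultimately show ?thesis using o by blast
  qed
  have "is_gate q K L ?R ?A ?W" unfolding is_gate_def
  proof (intro conjI subsetI ballI)
    fix \<xi> assume xi: "\<xi> \<in> ?W"
    then obtain U t where U: "U \<in> G" "t \<in> ?T" "\<xi> = two_spin K L U r t" by blast
    obtain \<omega> where w: "\<omega> \<in> opt_paths q K L ?R ?A" "\<xi> \<in> set \<omega>" using only[OF xi] by blast
    have "disagreements \<xi> = 2 * K + 2" using U disagreements_two_spin[of r t U] good[OF U(1)] by (auto simp: good_def)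
    then have "energy K L \<xi> = Max (energy K L ` set \<omega>)" using energy_e0 w(1) by (simp add: opt height_def)
    moreover have "\<xi> \<in> configs q K L" using U r two_spin_configs by blast
    ultimately show "\<xi> \<in> saddles q K L ?R ?A" unfolding saddles_def using w by blast
  next
    fix \<omega> assume "\<omega> \<in> opt_paths q K L ?R ?A"
    then obtain t where t: "t \<in> ?T" "\<omega> \<in> paths q K L ?R (const_config K L t)" "height K L \<omega> = e0"
      unfolding opt by blast
    have "\<omega> \<noteq> []" and sub: "set \<omega> \<subseteq> configs q K L" using t(2) by (simp_all add: paths_def)
    then have "\<And>\<sigma>. \<sigma> \<in> set \<omega> \<Longrightarrow> disagreements \<sigma> \<le> 2 * K + 2" using height_le t(3) by fastforce
    then obtain \<sigma> where "\<sigma> \<in> set \<omega>" "supp r \<sigma> \<in> G" "perimeter (supp r \<sigma>) = disagreements \<sigma>" using hit[OF t(2,1)] by blast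
    then have "\<sigma> \<in> set \<omega> \<inter> ?W" using WI[of \<sigma>] sub by blast
    then show "set \<omega> \<inter> ?W \<noteq> {}" by blast
  qed
  moreover have "\<exists>\<omega>\<in>opt_paths q K L ?R ?A. set \<omega> \<inter> W' = {}" if W': "W' \<subset> ?W" for W'
  proof -
    obtain \<xi> where xi: "\<xi> \<in> ?W" "\<xi> \<notin> W'" using W' by blast
    obtain \<omega> where "\<omega> \<in> opt_paths q K L ?R ?A" "set \<omega> \<inter> ?W \<subseteq> {\<xi>}" using only[OF xi(1)] by blast
    then show ?thesis using W' xi(2) by blast
  qed
  ultimately show ?thesis unfolding is_minimal_gate_def by blast
qed

lemma B_bar_eq: "B_bar K L h a b r t = {two_spin K L U r t | U. U \<in> bars h a b}"
  unfolding B_bar_def bars_def by blast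

lemma R_bar_eq: "R_bar K L a b r t = {two_spin K L U r t | U. U \<in> rects a b}"
  unfolding R_bar_def rects_def by blast

lemma swap_family: "{two_spin K L U t r | U. U \<in> G} = {two_spin K L U r t | U. U \<in> (-) V ` G}"
proof -
  have "{two_spin K L U t r | U. U \<in> G} = {two_spin K L (V - U) r t | U. U \<in> G}"
    unfolding two_spin_compl[of _ t r] ..
  then show ?thesis by blast
qed

text \<open>Occupying \<open>U\<close> by \<open>r\<close> in a sea of \<open>t\<close> is the same as occupying the complement of \<open>U\<close> by \<open>t\<close> in
  a sea of \<open>r\<close>.\<close>

lemma minimal_gates_both_orientations:
  assumes "2 \<le> q" "r \<in> spins q" "set_gate G"
    and F: "\<And>t t'. F t t' = {two_spin K L U t t' | U. U \<in> G}"
  shows "is_minimal_gate q K L (const_config K L r) (stable_configs q K L - {const_config K L r}) (\<Union>t\<in>spins q - {r}. F r t)"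
    "is_minimal_gate q K L (const_config K L r) (stable_configs q K L - {const_config K L r}) (\<Union>t\<in>spins q - {r}. F t r)"
proof -
  have swap: "(\<Union>t\<in>spins q - {r}. {two_spin K L U t r | U. U \<in> G}) =
      (\<Union>t\<in>spins q - {r}. {two_spin K L U r t | U. U \<in> (-) V ` G})"
    by (intro SUP_cong refl swap_family)
  show "is_minimal_gate q K L (const_config K L r) (stable_configs q K L - {const_config K L r}) (\<Union>t\<in>spins q - {r}. F r t)"
    unfolding F by (rule minimal_gate_if_set_gate[OF assms(1-3)])
  show "is_minimal_gate q K L (const_config K L r) (stable_configs q K L - {const_config K L r}) (\<Union>t\<in>spins q - {r}. F t r)"
    unfolding F swap by (rule minimal_gate_if_set_gate[OF assms(1,2) set_gate_compl[OF assms(3)]])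
qed

end

theorem theorem3p3:
  fixes q K L r :: nat
  assumes "q > 2" and "K \<ge> 3" and "K < L" and "L \<ge> 3" and "r \<in> spins q"
  defines "R \<equiv> const_config K L r"
  defines "A \<equiv> stable_configs q K L - {const_config K L r}"
  shows
    "(is_minimal_gate q K L R A (\<Union>t\<in>spins q - {r}. P_bar K L r t) \<and>
      is_minimal_gate q K L R A (\<Union>t\<in>spins q - {r}. P_tilde K L r t)) \<and>
     (is_minimal_gate q K L R A (\<Union>t\<in>spins q - {r}. Q_bar K L r t) \<and>
      is_minimal_gate q K L R A (\<Union>t\<in>spins q - {r}. Q_tilde K L r t)) \<and>
     (\<forall>i\<in>{1..K - 3}.
        is_minimal_gate q K L R A (\<Union>t\<in>spins q - {r}. H_bar K L i r t) \<and>
        is_minimal_gate q K L R A (\<Union>t\<in>spins q - {r}. H_tilde K L i r t)) \<and>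
     (\<forall>j\<in>{2..L - 3}. \<forall>h\<in>{1..K - 1}.
        is_minimal_gate q K L R A (\<Union>t\<in>spins q - {r}. W_set K L j h r t))"
proof -
  interpret torus K L using assms by unfold_locales auto
  have q: "2 \<le> q" using assms(1) by simp
  note gates = minimal_gates_both_orientations[OF q assms(5), folded R_def A_def]
  show ?thesis
  proof (intro conjI ballI)
    have G: "set_gate (bars (K - 1) 1 K)" using assms by (intro set_gate_bars) auto
    note P = gates[OF G, of "B_bar K L (K - 1) 1 K", OF B_bar_eq]
    show "is_minimal_gate q K L R A (\<Union>t\<in>spins q - {r}. P_bar K L r t)"
      using P(1) unfolding P_bar_def .
    show "is_minimal_gate q K L R A (\<Union>t\<in>spins q - {r}. P_tilde K L r t)"
      using P(2) unfolding P_tilde_def B_tilde_def .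
  next
    have "Q_bar K L t t' = {two_spin K L U t t' | U. U \<in> rects 2 (K - 1) \<union> bars (K - 2) 1 K}" for t t'
      unfolding Q_bar_def R_bar_eq B_bar_eq by blast
    note Q = gates[OF set_gate_Q_family, of "Q_bar K L", OF this]
    show "is_minimal_gate q K L R A (\<Union>t\<in>spins q - {r}. Q_bar K L r t)"
      by (rule Q(1))
    show "is_minimal_gate q K L R A (\<Union>t\<in>spins q - {r}. Q_tilde K L r t)"
      using Q(2) unfolding Q_bar_def Q_tilde_def R_tilde_def B_tilde_def .
  next
    fix i assume "i \<in> {1..K - 3}"
    then have "set_gate (bars i 1 K \<union> (\<Union>h\<in>{i + 1..K - 2}. bars h 1 (K - 1)))" by (intro set_gate_H_family) auto
    moreover have "H_bar K L i t t' =
      {two_spin K L U t t' | U. U \<in> bars i 1 K \<union> (\<Union>h\<in>{i + 1..K - 2}. bars h 1 (K - 1))}" for t t'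
      unfolding H_bar_def B_bar_eq by blast
    ultimately have H: "is_minimal_gate q K L R A (\<Union>t\<in>spins q - {r}. H_bar K L i r t)"
      "is_minimal_gate q K L R A (\<Union>t\<in>spins q - {r}. H_bar K L i t r)" by (rule gates)+
    show "is_minimal_gate q K L R A (\<Union>t\<in>spins q - {r}. H_bar K L i r t)"
      by (rule H(1))
    show "is_minimal_gate q K L R A (\<Union>t\<in>spins q - {r}. H_tilde K L i r t)"
      using H(2) unfolding H_bar_def H_tilde_def B_tilde_def .
  next
    fix j h assume jh: "j \<in> {2..L - 3}" "h \<in> {1..K - 1}"
    have "K * 2 \<le> K * j" using jh by (intro mult_le_mono2) auto
    then have "2 * K - 1 \<le> K * j + h" by linarith
    then have G: "set_gate (bars h j K)" using jh assms by (intro set_gate_bars) auto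
    show "is_minimal_gate q K L R A (\<Union>t\<in>spins q - {r}. W_set K L j h r t)"
      using gates(1)[OF G, of "B_bar K L h j K", OF B_bar_eq] unfolding W_set_def .
  qed
qed

end
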